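(* Let $(M,g)$ be a complete and non-compact gradient Yamabe soliton, i.e. there are a smooth function $f$ on $M$ and a constant $\rho\in\mathbb{R}$ with $(R-\rho)g=\nabla^2 f$ on $M$, where $R$ is the scalar curvature of $g$. Suppose $\rho\ge 0$ and $\liminf_{x\to\infty}R(x)\ge 0$. Then $R\ge 0$ on $M$. Furthermore, if $(M,g)$ is not scalar flat (i.e. $R$ is not identically $0$), then $R>0$ everywhere on $M$.
   Context: $(M,g)$ is a smooth connected Riemannian manifold of dimension $n$ (without boundary), and $\nabla^2 f$ is the Hessian of $f$ with respect to $g$. The notation $\liminf_{x\to\infty}R(x)$ means the lower limit as $x$ leaves every compact subset of $M$, i.e. $\sup_{K}\inf_{M\setminus K}R$ over compact $K\subset M$. *)

theory Defs
  imports "HOL-Analysis.Analysis"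
begin

section \<open>Smooth functions on open subsets of Euclidean space\<close>

definition partial_deriv :: "'n::finite \<Rightarrow> (real^'n \<Rightarrow> real) \<Rightarrow> real^'n \<Rightarrow> real" where
  "partial_deriv i F x = frechet_derivative F (at x) (axis i 1)"

text \<open>For open \<open>S\<close> this is \<open>C\<^sup>\<infinity>\<close>: all iterated partial derivatives of all orders exist on \<open>S\<close> and
  are again differentiable there (hence continuous).\<close>

definition smooth_on :: "(real^'n::finite) set \<Rightarrow> (real^'n \<Rightarrow> real) \<Rightarrow> bool" where
  "smooth_on S F \<longleftrightarrow> (\<forall>is. \<forall>x\<in>S. foldr partial_deriv is F differentiable (at x))"

section \<open>Smooth manifolds\<close>

text \<open>A manifold is a type \<open>'a\<close> with a Hausdorff, second countable topology together with a smooth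
  atlas. A chart is a pair \<open>(U, \<phi>)\<close>; the values of \<open>\<phi>\<close> outside of \<open>U\<close> are irrelevant. The dimension
  is \<open>CARD('n)\<close>, hence at least 1.\<close>

type_synonym ('a, 'n) chart = "'a set \<times> ('a \<Rightarrow> real^'n)"

definition chart_image :: "('a, 'n::finite) chart \<Rightarrow> (real^'n) set" where
  "chart_image c = snd c ` fst c"

definition chart_inv :: "('a, 'n::finite) chart \<Rightarrow> real^'n \<Rightarrow> 'a" where
  "chart_inv c = inv_into (fst c) (snd c)"

definition is_chart :: "('a::topological_space, 'n::finite) chart \<Rightarrow> bool" where
  "is_chart c \<longleftrightarrow> open (fst c) \<and> open (chart_image c) \<and>
     homeomorphism (fst c) (chart_image c) (snd c) (chart_inv c)"

definition transition :: "('a, 'n::finite) chart \<Rightarrow> ('a, 'n) chart \<Rightarrow> real^'n \<Rightarrow> real^'n" where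
  "transition c d = snd d \<circ> chart_inv c"

definition smooth_atlas :: "('a::topological_space, 'n::finite) chart set \<Rightarrow> bool" where
  "smooth_atlas A \<longleftrightarrow>
     (\<forall>c\<in>A. is_chart c) \<and> (\<Union>c\<in>A. fst c) = UNIV \<and>
     (\<forall>c\<in>A. \<forall>d\<in>A. \<forall>k. smooth_on (snd c ` (fst c \<inter> fst d)) (\<lambda>x. transition c d x $ k))"

definition smooth_function :: "('a, 'n::finite) chart set \<Rightarrow> ('a \<Rightarrow> real) \<Rightarrow> bool" where
  "smooth_function A f \<longleftrightarrow> (\<forall>c\<in>A. smooth_on (chart_image c) (f \<circ> chart_inv c))"

section \<open>Riemannian metrics\<close>

text \<open>A metric assigns to each chart \<open>c\<close> of the atlas its coefficient matrix
  \<open>g c x $ i $ j = g(\<partial>\<^sub>i, \<partial>\<^sub>j)\<close> at the point with coordinates \<open>x\<close>. The last clause is the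
  transformation law of a covariant 2-tensor.\<close>

type_synonym ('a, 'n) metric = "('a, 'n) chart \<Rightarrow> real^'n \<Rightarrow> real^'n^'n"

definition riemannian_metric :: "('a, 'n::finite) chart set \<Rightarrow> ('a, 'n) metric \<Rightarrow> bool" where
  "riemannian_metric A g \<longleftrightarrow>
     (\<forall>c\<in>A. \<forall>i j. smooth_on (chart_image c) (\<lambda>x. g c x $ i $ j)) \<and>
     (\<forall>c\<in>A. \<forall>x\<in>chart_image c. transpose (g c x) = g c x) \<and>
     (\<forall>c\<in>A. \<forall>x\<in>chart_image c. \<forall>v. v \<noteq> 0 \<longrightarrow> v \<bullet> (g c x *v v) > 0) \<and>
     (\<forall>c\<in>A. \<forall>d\<in>A. \<forall>x\<in>snd c ` (fst c \<inter> fst d).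
        let J = jacobian (transition c d) (at x)
        in g c x = transpose J ** g d (transition c d x) ** J)"

section \<open>Levi-Civita connection, Hessian and curvature in coordinates\<close>

definition christoffel ::
  "(real^'n \<Rightarrow> real^'n^'n) \<Rightarrow> 'n::finite \<Rightarrow> 'n \<Rightarrow> 'n \<Rightarrow> real^'n \<Rightarrow> real" where
  "christoffel G k i j x =
     (\<Sum>l\<in>UNIV. matrix_inv (G x) $ k $ l *
        (partial_deriv i (\<lambda>y. G y $ j $ l) x + partial_deriv j (\<lambda>y. G y $ i $ l) x
         - partial_deriv l (\<lambda>y. G y $ i $ j) x)) / 2"

definition hessian ::
  "(real^'n \<Rightarrow> real^'n^'n) \<Rightarrow> (real^'n \<Rightarrow> real) \<Rightarrow> 'n::finite \<Rightarrow> 'n \<Rightarrow> real^'n \<Rightarrow> real" where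
  "hessian G F i j x =
     partial_deriv i (partial_deriv j F) x
     - (\<Sum>k\<in>UNIV. christoffel G k i j x * partial_deriv k F x)"

text \<open>\<open>riemann G l k i j\<close> is the \<open>\<partial>\<^sub>l\<close>-component of
  \<open>R(\<partial>\<^sub>i, \<partial>\<^sub>j) \<partial>\<^sub>k = \<nabla>\<^sub>i \<nabla>\<^sub>j \<partial>\<^sub>k - \<nabla>\<^sub>j \<nabla>\<^sub>i \<partial>\<^sub>k\<close>, and \<open>Ric(Y, Z)\<close> is the trace of
  \<open>X \<mapsto> R(X, Y) Z\<close>; with these signs round spheres have positive scalar curvature.\<close>

definition riemann ::
  "(real^'n \<Rightarrow> real^'n^'n) \<Rightarrow> 'n::finite \<Rightarrow> 'n \<Rightarrow> 'n \<Rightarrow> 'n \<Rightarrow> real^'n \<Rightarrow> real" where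
  "riemann G l k i j x =
     partial_deriv i (christoffel G l j k) x - partial_deriv j (christoffel G l i k) x
     + (\<Sum>m\<in>UNIV. christoffel G l i m x * christoffel G m j k x
                - christoffel G l j m x * christoffel G m i k x)"

definition ricci ::
  "(real^'n \<Rightarrow> real^'n^'n) \<Rightarrow> 'n::finite \<Rightarrow> 'n \<Rightarrow> real^'n \<Rightarrow> real" where
  "ricci G j k x = (\<Sum>i\<in>UNIV. riemann G i k i j x)"

definition scalar_coord :: "(real^'n::finite \<Rightarrow> real^'n^'n) \<Rightarrow> real^'n \<Rightarrow> real" where
  "scalar_coord G x = (\<Sum>j\<in>UNIV. \<Sum>k\<in>UNIV. matrix_inv (G x) $ j $ k * ricci G j k x)"

text \<open>The scalar curvature at \<open>p\<close> is computed in an arbitrarily chosen chart around \<open>p\<close>; for a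
  Riemannian metric the result does not depend on the choice.\<close>

definition scalar_curvature ::
  "('a, 'n::finite) chart set \<Rightarrow> ('a, 'n) metric \<Rightarrow> 'a \<Rightarrow> real" where
  "scalar_curvature A g p =
     (let c = (SOME c. c \<in> A \<and> p \<in> fst c) in scalar_coord (g c) (snd c p))"

section \<open>Completeness\<close>

text \<open>Geodesics defined on all of \<open>\<real>\<close>: in every chart, the coordinate curve \<open>x\<close> satisfies
  \<open>x\<^sub>k'' + \<Gamma>\<^sup>k\<^sub>i\<^sub>j x\<^sub>i' x\<^sub>j' = 0\<close> (constant curves are geodesics).\<close>

definition geodesic ::
  "('a::topological_space, 'n::finite) chart set \<Rightarrow> ('a, 'n) metric \<Rightarrow> (real \<Rightarrow> 'a) \<Rightarrow> bool" where
  "geodesic A g \<gamma> \<longleftrightarrow> continuous_on UNIV \<gamma> \<and>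
     (\<forall>c\<in>A. \<forall>t. \<gamma> t \<in> fst c \<longrightarrow>
        (let x = snd c \<circ> \<gamma>; v = (\<lambda>s. vector_derivative x (at s))
         in x differentiable (at t) \<and>
            (v has_vector_derivative
               (\<chi> k. - (\<Sum>i\<in>UNIV. \<Sum>j\<in>UNIV.
                          christoffel (g c) k i j (x t) * v t $ i * v t $ j))) (at t)))"

text \<open>Geodesic completeness: through every point, with every initial velocity, there is a geodesic
  defined for all times.\<close>

definition complete_metric ::
  "('a::topological_space, 'n::finite) chart set \<Rightarrow> ('a, 'n) metric \<Rightarrow> bool" where
  "complete_metric A g \<longleftrightarrow>
     (\<forall>c\<in>A. \<forall>p\<in>fst c. \<forall>v. \<exists>\<gamma>. geodesic A g \<gamma> \<and> \<gamma> 0 = p \<and>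
        ((snd c \<circ> \<gamma>) has_vector_derivative v) (at 0))"

section \<open>Gradient Yamabe solitons\<close>

definition gradient_yamabe_soliton ::
  "('a, 'n::finite) chart set \<Rightarrow> ('a, 'n) metric \<Rightarrow> ('a \<Rightarrow> real) \<Rightarrow> real \<Rightarrow> bool" where
  "gradient_yamabe_soliton A g f \<rho> \<longleftrightarrow>
     smooth_function A f \<and>
     (\<forall>c\<in>A. \<forall>p\<in>fst c. \<forall>i j.
        (scalar_curvature A g p - \<rho>) * g c (snd c p) $ i $ j
        = hessian (g c) (f \<circ> chart_inv c) i j (snd c p))"

definition liminf_at_infinity :: "('a::topological_space \<Rightarrow> real) \<Rightarrow> ereal" where
  "liminf_at_infinity R = (SUP K\<in>{K. compact K}. INF x\<in>-K. ereal (R x))"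

end

theory Submission
  imports Defs
begin

text \<open>Let \<open>n\<close> be the dimension and \<open>R\<close> the scalar curvature. The soliton equation \<open>\<nabla>\<^sup>2 f = (R - \<rho>) g\<close> forces
  \<^item> \<open>(n - 1) \<Delta>R + \<langle>\<nabla>R, \<nabla>f\<rangle> / 2 + R (R - \<rho>) = 0\<close>,

  which is \<open>soliton_scalar_equation\<close>. If \<open>R\<close> were negative somewhere, the condition on the lower limit
  at infinity would make \<open>R\<close> attain a negative global minimum. There \<open>\<nabla>R = 0\<close> and \<open>\<Delta>R \<ge> 0\<close>, while
  \<open>R (R - \<rho>) > 0\<close> because \<open>R < 0 \<le> \<rho>\<close>: a contradiction. Hence \<open>R \<ge> 0\<close>, and now the equation says that
  \<open>R\<close> is a supersolution of a linear elliptic operator, so that by the strong minimum principle the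
  closed set of zeros of \<open>R\<close> is open as well. By connectedness it is empty or everything.

  The equation for \<open>R\<close> comes from commuting derivatives. Differentiating the soliton equation and
  antisymmetrizing expresses the curvature applied to \<open>\<nabla>f\<close> by \<open>\<nabla>R\<close>; one more divergence brings in
  \<open>\<Delta>R\<close>, and the divergence of the Ricci tensor is replaced by \<open>\<nabla>R / 2\<close> with the contracted Bianchi
  identity. Each term of the equation is invariant under changes of coordinates. So it is checked at
  one point at a time, in coordinates in which the metric is standard and the Christoffel symbols
  vanish at that point. There covariant derivatives turn into partial derivatives, and the Bianchi
  identity becomes a comparison of third derivatives of the metric.

  The price for this is the transformation behaviour of the Christoffel symbols, the Hessian and the
  curvature under maps that pull one metric back to another (\<open>metric_pullback\<close>). The same lemmas show
  that the scalar curvature does not depend on the chart in which it is computed, which is what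
  makes it a smooth function in every chart.\<close>

notation partial_deriv ("\<partial>")

section \<open>Calculus of smooth functions\<close>

lemma sum_axis: "(\<Sum>j\<in>UNIV. axis i (1::real) $ j * f j) = f i"
proof -
  have "(\<Sum>j\<in>UNIV. axis i (1::real) $ j * f j) = (\<Sum>j\<in>UNIV. if i = j then f j else 0)"
    by (intro sum.cong) (auto simp: axis_def)
  then show ?thesis by simp
qed

lemma partial_deriv_eqI:
  "(F has_derivative F') (at x) \<Longrightarrow> \<partial> i F x = F' (axis i 1)"
  unfolding partial_deriv_def by (simp add: frechet_derivative_at [symmetric])

lemma partial_deriv_cong:
  assumes "open S" "x \<in> S" "\<And>y. y \<in> S \<Longrightarrow> F y = H y"
  shows "\<partial> i F x = \<partial> i H x"
proof -
  have "(F has_derivative D) (at x) \<longleftrightarrow> (H has_derivative D) (at x)" for D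
    using has_derivative_transform_within_open [OF _ assms(1,2)] assms(3) by metis
  then show ?thesis
    by (simp add: partial_deriv_def frechet_derivative_def)
qed

lemma has_derivative_partial_deriv:
  assumes "F differentiable (at x)"
  shows "(F has_derivative (\<lambda>v. \<Sum>i\<in>UNIV. v $ i * \<partial> i F x)) (at x)"
proof -
  obtain D where D: "(F has_derivative D) (at x)"
    using assms by (auto simp: differentiable_def)
  then interpret bounded_linear D
    by (rule has_derivative_bounded_linear)
  have "D v = (\<Sum>i\<in>UNIV. v $ i * \<partial> i F x)" for v
  proof -
    have "D v = D (\<Sum>i\<in>UNIV. v $ i *\<^sub>R axis i 1)"
      using basis_expansion [of v] by (simp add: scalar_mult_eq_scaleR)
    also have "\<dots> = (\<Sum>i\<in>UNIV. v $ i * \<partial> i F x)"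
      by (simp add: sum scaleR partial_deriv_eqI [OF D])
    finally show ?thesis .
  qed
  then have "D = (\<lambda>v. \<Sum>i\<in>UNIV. v $ i * \<partial> i F x)" by (rule ext)
  with D show ?thesis by simp
qed

lemma smooth_on_differentiable: "smooth_on S F \<Longrightarrow> x \<in> S \<Longrightarrow> F differentiable (at x)"
  unfolding smooth_on_def by (metis foldr.simps(1) id_apply)

lemma smooth_on_partial_deriv: "smooth_on S F \<Longrightarrow> smooth_on S (\<partial> i F)"
  unfolding smooth_on_def
proof (intro allI ballI)
  fix "is" x assume "\<forall>is. \<forall>x\<in>S. foldr \<partial> is F differentiable at x" "x \<in> S"
  then have "foldr \<partial> (is @ [i]) F differentiable at x" by blast
  then show "foldr \<partial> is (\<partial> i F) differentiable at x" by simp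
qed

lemma smooth_on_subset: "smooth_on S F \<Longrightarrow> T \<subseteq> S \<Longrightarrow> smooth_on T F"
  unfolding smooth_on_def by blast

lemma smooth_on_continuous_on: "smooth_on S F \<Longrightarrow> continuous_on S F"
  by (meson differentiable_imp_continuous_within smooth_on_differentiable
      continuous_at_imp_continuous_on)

text \<open>A coinduction principle: a class of functions that is closed under taking partial
  derivatives, up to the values outside of \<open>S\<close>, consists of smooth functions.\<close>

lemma smooth_on_coinduct:
  assumes S: "open S" and "P F"
    and diff: "\<And>F x. P F \<Longrightarrow> x \<in> S \<Longrightarrow> F differentiable (at x)"
    and pd: "\<And>F i. P F \<Longrightarrow> \<exists>F'. P F' \<and> (\<forall>x\<in>S. \<partial> i F x = F' x)"
  shows "smooth_on S F"
  unfolding smooth_on_def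
proof (intro allI ballI)
  fix "is" :: "'a list" and x assume x: "x \<in> S"
  have "\<exists>F'. P F' \<and> (\<forall>x\<in>S. foldr \<partial> is F x = F' x)"
  proof (induction "is")
    case Nil
    then show ?case using \<open>P F\<close> by auto
  next
    case (Cons i "is")
    then obtain F' where F': "P F'" "\<forall>x\<in>S. foldr \<partial> is F x = F' x" by blast
    then have "\<forall>x\<in>S. \<partial> i (foldr \<partial> is F) x = \<partial> i F' x"
      using partial_deriv_cong [OF S] by blast
    then show ?case using pd [OF F'(1), of i] by auto
  qed
  then obtain F' where F': "P F'" "\<And>x. x \<in> S \<Longrightarrow> F' x = foldr \<partial> is F x" by metis
  obtain D where "(F' has_derivative D) (at x)"
    using diff [OF F'(1) x] by (auto simp: differentiable_def)
  from has_derivative_transform_within_open [OF this S x F'(2)]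
  show "foldr \<partial> is F differentiable at x"
    by (auto simp: differentiable_def)
qed

lemma partial_deriv_const [simp]: "\<partial> i (\<lambda>x. c) x = 0"
  by (simp add: partial_deriv_eqI [OF has_derivative_const])

lemma partial_deriv_add:
  assumes "F differentiable (at x)" "H differentiable (at x)"
  shows "\<partial> i (\<lambda>y. F y + H y) x = \<partial> i F x + \<partial> i H x"
  by (rule partial_deriv_eqI [OF has_derivative_add [OF assms[unfolded frechet_derivative_works]],
        folded partial_deriv_def])

lemma partial_deriv_diff:
  assumes "F differentiable (at x)" "H differentiable (at x)"
  shows "\<partial> i (\<lambda>y. F y - H y) x = \<partial> i F x - \<partial> i H x"
  by (rule partial_deriv_eqI [OF has_derivative_diff [OF assms[unfolded frechet_derivative_works]],
        folded partial_deriv_def])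

lemma partial_deriv_mult:
  assumes "F differentiable (at x)" "H differentiable (at x)"
  shows "\<partial> i (\<lambda>y. F y * H y) x = \<partial> i F x * H x + F x * \<partial> i H x"
  by (subst partial_deriv_eqI [OF has_derivative_mult [OF assms[unfolded frechet_derivative_works]]])
    (simp add: partial_deriv_def)

lemma partial_deriv_cmult:
  assumes "F differentiable (at x)"
  shows "\<partial> i (\<lambda>y. c * F y) x = c * \<partial> i F x"
  using partial_deriv_mult [of "\<lambda>_. c" x F i] assms by simp

lemma partial_deriv_divide:
  assumes "F differentiable (at x)"
  shows "\<partial> i (\<lambda>y. F y / c) x = \<partial> i F x / c"
  using partial_deriv_cmult [OF assms, of i "1 / c"] by simp

lemma partial_deriv_minus:
  assumes "F differentiable (at x)"
  shows "\<partial> i (\<lambda>y. - F y) x = - \<partial> i F x"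
  using partial_deriv_cmult [of F x i "-1"] assms by simp

lemma partial_deriv_sum:
  assumes "\<And>a. a \<in> I \<Longrightarrow> F a differentiable (at x)"
  shows "\<partial> i (\<lambda>y. \<Sum>a\<in>I. F a y) x = (\<Sum>a\<in>I. \<partial> i (F a) x)"
proof -
  have "((\<lambda>y. \<Sum>a\<in>I. F a y) has_derivative (\<lambda>v. \<Sum>a\<in>I. frechet_derivative (F a) (at x) v)) (at x)"
    by (rule has_derivative_sum) (use assms in \<open>simp add: frechet_derivative_works [symmetric]\<close>)
  from partial_deriv_eqI [OF this] show ?thesis
    by (simp add: partial_deriv_def)
qed

lemma partial_deriv_exp:
  fixes F :: "real^'n::finite \<Rightarrow> real"
  assumes "F differentiable (at x)"
  shows "\<partial> i (\<lambda>y. exp (F y)) x = exp (F x) * \<partial> i F x"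
  by (subst partial_deriv_eqI [OF has_derivative_exp [OF assms[unfolded frechet_derivative_works]]])
    (simp add: partial_deriv_def)

lemma partial_deriv_inverse:
  fixes F :: "real^'n::finite \<Rightarrow> real"
  assumes "F differentiable (at x)" "F x \<noteq> 0"
  shows "\<partial> i (\<lambda>y. inverse (F y)) x = - (\<partial> i F x * (inverse (F x) * inverse (F x)))"
  by (subst partial_deriv_eqI [OF Deriv.has_derivative_inverse [OF assms(2) assms(1)[unfolded frechet_derivative_works]]])
    (simp add: partial_deriv_def)

lemma has_derivative_vec_partial_deriv:
  fixes \<phi> :: "real^'m::finite \<Rightarrow> real^'n::finite"
  assumes "\<And>a. (\<lambda>y. \<phi> y $ a) differentiable (at x)"
  shows "(\<phi> has_derivative (\<lambda>v. \<chi> a. \<Sum>i\<in>UNIV. v $ i * \<partial> i (\<lambda>y. \<phi> y $ a) x)) (at x)"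
  unfolding has_derivative_componentwise_within [of \<phi>]
proof
  fix b :: "real^'n" assume "b \<in> Basis"
  then obtain a where b: "b = axis a 1" by (auto simp: Basis_vec_def)
  show "((\<lambda>y. \<phi> y \<bullet> b) has_derivative
      (\<lambda>v. (\<chi> a. \<Sum>i\<in>UNIV. v $ i * \<partial> i (\<lambda>y. \<phi> y $ a) x) \<bullet> b)) (at x)"
    using has_derivative_partial_deriv [OF assms [of a]] by (simp add: b inner_axis)
qed

lemma has_derivative_chain:
  fixes \<phi> :: "real^'m::finite \<Rightarrow> real^'n::finite"
  assumes "\<And>a. (\<lambda>y. \<phi> y $ a) differentiable (at x)" "F differentiable (at (\<phi> x))"
  shows "((\<lambda>y. F (\<phi> y)) has_derivative
    (\<lambda>v. \<Sum>a\<in>UNIV. (\<Sum>i\<in>UNIV. v $ i * \<partial> i (\<lambda>y. \<phi> y $ a) x) * \<partial> a F (\<phi> x))) (at x)"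
  using has_derivative_compose [OF has_derivative_vec_partial_deriv [OF assms(1)]
      has_derivative_partial_deriv [OF assms(2)]]
  by (simp only: vec_lambda_beta)

lemma partial_deriv_chain:
  fixes \<phi> :: "real^'m::finite \<Rightarrow> real^'n::finite"
  assumes "\<And>a. (\<lambda>y. \<phi> y $ a) differentiable (at x)" "F differentiable (at (\<phi> x))"
  shows "\<partial> i (\<lambda>y. F (\<phi> y)) x = (\<Sum>a\<in>UNIV. \<partial> i (\<lambda>y. \<phi> y $ a) x * \<partial> a F (\<phi> x))"
  using partial_deriv_eqI [OF has_derivative_chain [OF assms]] by (simp only: sum_axis)

text \<open>Smoothness of sums, products, reciprocals, exponentials and compositions is proved at one
  stroke: the algebra that they generate together is closed under partial derivatives.\<close>

inductive smooth_closure :: "(real^'n::finite) set \<Rightarrow> (real^'n \<Rightarrow> real) \<Rightarrow> bool" for S where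
  base: "smooth_on S F \<Longrightarrow> smooth_closure S F"
| const: "smooth_closure S (\<lambda>x. c)"
| comp: "smooth_on T F \<Longrightarrow> (\<And>a. smooth_on S (\<lambda>x. \<phi> x $ a)) \<Longrightarrow> \<phi> ` S \<subseteq> T \<Longrightarrow>
    smooth_closure S (\<lambda>x. F (\<phi> x :: real^'n))"
| add: "smooth_closure S F \<Longrightarrow> smooth_closure S H \<Longrightarrow> smooth_closure S (\<lambda>x. F x + H x)"
| mult: "smooth_closure S F \<Longrightarrow> smooth_closure S H \<Longrightarrow> smooth_closure S (\<lambda>x. F x * H x)"
| inverse: "smooth_closure S F \<Longrightarrow> (\<forall>x\<in>S. F x \<noteq> 0) \<Longrightarrow> smooth_closure S (\<lambda>x. inverse (F x))"
| exp: "smooth_closure S F \<Longrightarrow> smooth_closure S (\<lambda>x. exp (F x))"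

lemma smooth_closure_differentiable:
  "smooth_closure S F \<Longrightarrow> x \<in> S \<Longrightarrow> F differentiable (at x)"
proof (induction rule: smooth_closure.induct)
  case (comp T F \<phi>)
  have "F differentiable (at (\<phi> x))"
    using comp by (intro smooth_on_differentiable [of T]) auto
  moreover have "(\<lambda>y. \<phi> y $ a) differentiable (at x)" for a
    using comp by (intro smooth_on_differentiable [of S]) auto
  ultimately show ?case
    using has_derivative_chain [of \<phi> x F] unfolding differentiable_def by blast
next
  case (inverse F)
  then show ?case by (intro differentiable_inverse) auto
next
  case (exp F)
  then show ?case
    using has_derivative_exp unfolding differentiable_def by blast
qed (auto intro: smooth_on_differentiable differentiable_add differentiable_mult)

lemma smooth_closure_sum:
  assumes "finite I" "\<And>a. a \<in> I \<Longrightarrow> smooth_closure S (F a)"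
  shows "smooth_closure S (\<lambda>x. \<Sum>a\<in>I. F a x)"
  using assms by (induction I rule: finite_induct) (auto intro: smooth_closure.const smooth_closure.add)

lemma smooth_closure_partial_deriv:
  "smooth_closure S F \<Longrightarrow> \<exists>F'. smooth_closure S F' \<and> (\<forall>x\<in>S. \<partial> i F x = F' x)"
proof (induction rule: smooth_closure.induct)
  case (base F)
  then show ?case using smooth_on_partial_deriv smooth_closure.base by blast
next
  case (const c)
  then show ?case using smooth_closure.const by (auto intro!: exI [of _ "\<lambda>x. 0"])
next
  case (comp T F \<phi>)
  show ?case
  proof (intro exI conjI ballI)
    fix x assume "x \<in> S"
    then show "\<partial> i (\<lambda>x. F (\<phi> x)) x = (\<Sum>a\<in>UNIV. \<partial> i (\<lambda>y. \<phi> y $ a) x * \<partial> a F (\<phi> x))"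
      using comp by (intro partial_deriv_chain smooth_on_differentiable [of T F]
          smooth_on_differentiable [of S]) auto
  next
    have "smooth_closure S (\<lambda>x. \<partial> a F (\<phi> x))" for a
      by (rule smooth_closure.comp [OF smooth_on_partial_deriv]) (use comp in auto)
    moreover have "smooth_closure S (\<partial> i (\<lambda>y. \<phi> y $ a))" for a
      by (intro smooth_closure.base smooth_on_partial_deriv comp)
    ultimately show "smooth_closure S (\<lambda>x. \<Sum>a\<in>UNIV. \<partial> i (\<lambda>y. \<phi> y $ a) x * \<partial> a F (\<phi> x))"
      by (intro smooth_closure_sum smooth_closure.mult finite)
  qed
next
  case (add F H)
  then obtain F' H' where *: "smooth_closure S F'" "\<forall>x\<in>S. \<partial> i F x = F' x"
    "smooth_closure S H'" "\<forall>x\<in>S. \<partial> i H x = H' x" by blast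
  then show ?case
    using add * smooth_closure_differentiable [of S F] smooth_closure_differentiable [of S H]
    by (intro exI [of _ "\<lambda>x. F' x + H' x"]) (simp add: smooth_closure.add partial_deriv_add)
next
  case (mult F H)
  then obtain F' H' where *: "smooth_closure S F'" "\<forall>x\<in>S. \<partial> i F x = F' x"
    "smooth_closure S H'" "\<forall>x\<in>S. \<partial> i H x = H' x" by blast
  then show ?case
    using mult * smooth_closure_differentiable [of S F] smooth_closure_differentiable [of S H]
    by (intro exI [of _ "\<lambda>x. F' x * H x + F x * H' x"])
      (simp add: smooth_closure.add smooth_closure.mult partial_deriv_mult)
next
  case (inverse F)
  then obtain F' where *: "smooth_closure S F'" "\<forall>x\<in>S. \<partial> i F x = F' x" by blast
  show ?case
  proof (intro exI [of _ "\<lambda>x. (-1) * (F' x * (inverse (F x) * inverse (F x)))"] conjI ballI)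
    show "smooth_closure S (\<lambda>x. (-1) * (F' x * (inverse (F x) * inverse (F x))))"
      by (intro smooth_closure.mult smooth_closure.inverse smooth_closure.const inverse *)
    fix x assume "x \<in> S"
    then show "\<partial> i (\<lambda>x. inverse (F x)) x = (-1) * (F' x * (inverse (F x) * inverse (F x)))"
      using inverse * smooth_closure_differentiable [of S F] by (simp add: partial_deriv_inverse)
  qed
next
  case (exp F)
  then obtain F' where *: "smooth_closure S F'" "\<forall>x\<in>S. \<partial> i F x = F' x" by blast
  show ?case
    using exp * smooth_closure_differentiable [of S F]
    by (intro exI [of _ "\<lambda>x. exp (F x) * F' x"])
      (simp add: smooth_closure.mult smooth_closure.exp partial_deriv_exp)
qed

lemma smooth_closure_imp_smooth_on: "open S \<Longrightarrow> smooth_closure S F \<Longrightarrow> smooth_on S F"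
  by (erule smooth_on_coinduct)
    (assumption | rule smooth_closure_differentiable smooth_closure_partial_deriv)+

lemma partial_deriv_nth: "\<partial> i (\<lambda>x. x $ j) x = (if i = j then 1 else 0)"
  using partial_deriv_eqI [OF bounded_linear_imp_has_derivative [OF bounded_linear_vec_nth], of i j x]
  by (simp add: axis_def eq_commute)

context
  fixes S :: "(real^'n::finite) set"
  assumes S: "open S"
begin

lemma smooth_on_const: "smooth_on S (\<lambda>x. c)"
  by (rule smooth_closure_imp_smooth_on [OF S smooth_closure.const])

lemma smooth_on_add: "smooth_on S F \<Longrightarrow> smooth_on S H \<Longrightarrow> smooth_on S (\<lambda>x. F x + H x)"
  by (rule smooth_closure_imp_smooth_on [OF S], intro smooth_closure.intros(4) smooth_closure.base)

lemma smooth_on_mult: "smooth_on S F \<Longrightarrow> smooth_on S H \<Longrightarrow> smooth_on S (\<lambda>x. F x * H x)"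
  by (rule smooth_closure_imp_smooth_on [OF S], intro smooth_closure.mult smooth_closure.base)

lemma smooth_on_minus: "smooth_on S F \<Longrightarrow> smooth_on S (\<lambda>x. - F x)"
  using smooth_on_mult [OF smooth_on_const, of F "-1"] by simp

lemma smooth_on_diff: "smooth_on S F \<Longrightarrow> smooth_on S H \<Longrightarrow> smooth_on S (\<lambda>x. F x - H x)"
  using smooth_on_add [OF _ smooth_on_minus, of F H] by simp

lemma smooth_on_sum:
  "finite I \<Longrightarrow> (\<And>a. a \<in> I \<Longrightarrow> smooth_on S (F a)) \<Longrightarrow> smooth_on S (\<lambda>x. \<Sum>a\<in>I. F a x)"
  by (rule smooth_closure_imp_smooth_on [OF S], intro smooth_closure_sum smooth_closure.base)

lemma smooth_on_prod:
  "finite I \<Longrightarrow> (\<And>a. a \<in> I \<Longrightarrow> smooth_on S (F a)) \<Longrightarrow> smooth_on S (\<lambda>x. \<Prod>a\<in>I. F a x)"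
  by (induction I rule: finite_induct) (auto intro: smooth_on_const smooth_on_mult)

lemma smooth_on_inverse:
  "smooth_on S F \<Longrightarrow> (\<And>x. x \<in> S \<Longrightarrow> F x \<noteq> 0) \<Longrightarrow> smooth_on S (\<lambda>x. inverse (F x))"
  by (rule smooth_closure_imp_smooth_on [OF S], intro smooth_closure.inverse smooth_closure.base) auto

lemma smooth_on_exp: "smooth_on S F \<Longrightarrow> smooth_on S (\<lambda>x. exp (F x))"
  by (rule smooth_closure_imp_smooth_on [OF S], intro smooth_closure.exp smooth_closure.base)

lemma smooth_on_divide_numeral:
  "smooth_on S F \<Longrightarrow> smooth_on S (\<lambda>x. F x / numeral k)"
  using smooth_on_mult [OF smooth_on_const, of F "1 / numeral k"] by simp

lemma smooth_on_compose:
  fixes \<phi> :: "real^'n \<Rightarrow> real^'n"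
  assumes "smooth_on T F" "\<And>a. smooth_on S (\<lambda>x. \<phi> x $ a)" "\<And>x. x \<in> S \<Longrightarrow> \<phi> x \<in> T"
  shows "smooth_on S (\<lambda>x. F (\<phi> x))"
  by (rule smooth_closure_imp_smooth_on [OF S smooth_closure.comp [of T]]) (use assms in auto)

lemma smooth_on_nth: "smooth_on S (\<lambda>x. x $ j)"
proof (rule smooth_on_coinduct [where P = "\<lambda>F. F = (\<lambda>x. x $ j) \<or> (\<exists>c. F = (\<lambda>x. c))"])
  fix F :: "real^'n \<Rightarrow> real" and i assume "F = (\<lambda>x. x $ j) \<or> (\<exists>c. F = (\<lambda>x. c))"
  then show "\<exists>F'. (F' = (\<lambda>x. x $ j) \<or> (\<exists>c. F' = (\<lambda>x. c))) \<and> (\<forall>x\<in>S. \<partial> i F x = F' x)"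
    by (intro exI [of _ "\<lambda>x. if F = (\<lambda>x. x $ j) \<and> i = j then 1 else 0"])
      (auto simp: partial_deriv_nth)
next
  fix F :: "real^'n \<Rightarrow> real" and x assume "F = (\<lambda>x. x $ j) \<or> (\<exists>c. F = (\<lambda>x. c))"
  then show "F differentiable (at x)"
    by (auto intro: bounded_linear_imp_differentiable bounded_linear_vec_nth)
qed (use S in auto)

lemma smooth_on_cong:
  assumes "smooth_on S F" "\<And>x. x \<in> S \<Longrightarrow> H x = F x"
  shows "smooth_on S H"
proof (rule smooth_on_coinduct [where P = "\<lambda>H. \<exists>F. smooth_on S F \<and> (\<forall>x\<in>S. H x = F x)"])
  show "\<exists>F. smooth_on S F \<and> (\<forall>x\<in>S. H x = F x)" using assms by auto
next
  fix H :: "real^'n \<Rightarrow> real" and x assume "\<exists>F. smooth_on S F \<and> (\<forall>x\<in>S. H x = F x)" and x: "x \<in> S"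
  then obtain F D where "\<And>x. x \<in> S \<Longrightarrow> F x = H x" "(F has_derivative D) (at x)"
    using smooth_on_differentiable by (metis differentiable_def)
  then show "H differentiable (at x)"
    using has_derivative_transform_within_open [OF _ S x, of F D UNIV H]
    by (auto simp: differentiable_def)
next
  fix H :: "real^'n \<Rightarrow> real" and i assume "\<exists>F. smooth_on S F \<and> (\<forall>x\<in>S. H x = F x)"
  then show "\<exists>F'. (\<exists>F. smooth_on S F \<and> (\<forall>x\<in>S. F' x = F x)) \<and> (\<forall>x\<in>S. \<partial> i H x = F' x)"
    using partial_deriv_cong [OF S, of _ H] smooth_on_partial_deriv by blast
qed (use S in auto)

lemma smooth_on_det:
  fixes M :: "real^'n \<Rightarrow> real^'m::finite^'m"
  shows "(\<And>i j. smooth_on S (\<lambda>x. M x $ i $ j)) \<Longrightarrow> smooth_on S (\<lambda>x. det (M x))"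
  unfolding det_def by (intro smooth_on_sum smooth_on_mult smooth_on_prod smooth_on_const) auto

end

lemma invertible_matrix_inv:
  fixes M :: "real^'n::finite^'n"
  assumes "invertible M"
  shows "M ** matrix_inv M = mat 1" "matrix_inv M ** M = mat 1"
  using someI_ex [OF assms[unfolded invertible_def]] by (simp_all add: matrix_inv_def)

text \<open>By Cramer's rule the entries of an inverse matrix are quotients of determinants.\<close>

lemma smooth_on_matrix_inv:
  fixes M :: "real^'n::finite \<Rightarrow> real^'m::finite^'m"
  assumes S: "open S" and M: "\<And>i j. smooth_on S (\<lambda>x. M x $ i $ j)"
    and inv: "\<And>x. x \<in> S \<Longrightarrow> invertible (M x)"
  shows "smooth_on S (\<lambda>x. matrix_inv (M x) $ k $ l)"
proof (rule smooth_on_cong [OF S])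
  fix x assume x: "x \<in> S"
  have "M x *v column l (matrix_inv (M x)) = axis l 1"
    using invertible_matrix_inv(1) [OF inv [OF x]]
    by (simp add: matrix_vector_mult_basis [symmetric] matrix_vector_mul_assoc)
  then have "column l (matrix_inv (M x)) =
      (\<chi> k. det (\<chi> i j. if j = k then axis l 1 $ i else M x $ i $ j) / det (M x))"
    using cramer [of "M x"] inv [OF x] by (simp add: invertible_det_nz)
  then show "matrix_inv (M x) $ k $ l =
      det (\<chi> i j. if j = k then axis l 1 $ i else M x $ i $ j) * inverse (det (M x))"
    by (simp add: column_def vec_eq_iff field_class.field_divide_inverse)
next
  have "smooth_on S (\<lambda>x. if j = k then axis l 1 $ i else M x $ i $ j)" for i j
    using M smooth_on_const [OF S] by (cases "j = k") auto
  then show "smooth_on S (\<lambda>x. det (\<chi> i j. if j = k then axis l 1 $ i else M x $ i $ j) * inverse (det (M x)))"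
    using inv by (intro smooth_on_mult smooth_on_det smooth_on_inverse S M)
      (auto simp: invertible_det_nz)
qed

section \<open>Second derivatives\<close>

lemma has_real_derivative_line:
  assumes "F differentiable (at (x + t *\<^sub>R v))"
  shows "((\<lambda>t. F (x + t *\<^sub>R v)) has_real_derivative (\<Sum>i\<in>UNIV. v $ i * \<partial> i F (x + t *\<^sub>R v))) (at t)"
proof -
  have "((\<lambda>t. x + t *\<^sub>R v) has_derivative (\<lambda>s. s *\<^sub>R v)) (at t)"
    by (auto intro!: derivative_eq_intros)
  from has_derivative_compose [OF this has_derivative_partial_deriv [OF assms]]
  have "((\<lambda>t. F (x + t *\<^sub>R v)) has_derivative
      (\<lambda>s. s * (\<Sum>i\<in>UNIV. v $ i * \<partial> i F (x + t *\<^sub>R v)))) (at t)"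
    by (simp add: sum_distrib_left mult.assoc)
  then show ?thesis
    by (simp add: has_field_derivative_def mult_commute_abs)
qed

lemma has_real_derivative_axis:
  assumes "F differentiable (at (x + t *\<^sub>R axis i 1))"
  shows "((\<lambda>t. F (x + t *\<^sub>R axis i 1)) has_real_derivative \<partial> i F (x + t *\<^sub>R axis i 1)) (at t)"
  using has_real_derivative_line [OF assms] by (simp only: sum_axis)

text \<open>The second difference is symmetric in \<open>i\<close> and \<open>j\<close>. Applying the mean value theorem in one
  direction and then in the other expresses it by either of the two mixed derivatives, which
  therefore agree in the limit.\<close>

lemma second_difference_quotient:
  fixes F :: "real^'n::finite \<Rightarrow> real"
  assumes F: "smooth_on S F" and r: "ball x r \<subseteq> S" and h: "0 < h" "2 * h < r"
  shows "\<exists>\<xi> \<eta>. 0 < \<xi> \<and> \<xi> < h \<and> 0 < \<eta> \<and> \<eta> < h \<and>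
    F (x + h *\<^sub>R axis i 1 + h *\<^sub>R axis j 1) - F (x + h *\<^sub>R axis i 1) - F (x + h *\<^sub>R axis j 1) + F x
    = h * h * \<partial> j (\<partial> i F) (x + \<xi> *\<^sub>R axis i 1 + \<eta> *\<^sub>R axis j 1)"
proof -
  have mem: "x + s *\<^sub>R axis i 1 + t *\<^sub>R axis j 1 \<in> S" if "0 \<le> s" "s \<le> h" "0 \<le> t" "t \<le> h" for s t
  proof -
    have "norm (s *\<^sub>R axis i (1::real) + t *\<^sub>R axis j 1) \<le> s + t"
      using norm_triangle_ineq [of "s *\<^sub>R axis i (1::real)" "t *\<^sub>R axis j 1"] that by simp
    then show ?thesis
      using r that h by (auto simp: dist_norm subset_iff add.assoc norm_minus_commute)
  qed
  have diff: "F differentiable (at (x + s *\<^sub>R axis i 1 + t *\<^sub>R axis j 1))"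
    "\<partial> i F differentiable (at (x + s *\<^sub>R axis i 1 + t *\<^sub>R axis j 1))"
    if "0 \<le> s" "s \<le> h" "0 \<le> t" "t \<le> h" for s t
    using smooth_on_differentiable F smooth_on_partial_deriv mem that by blast+
  define \<phi> where "\<phi> s = F ((x + h *\<^sub>R axis j 1) + s *\<^sub>R axis i 1) - F (x + s *\<^sub>R axis i 1)" for s
  have "(\<phi> has_real_derivative \<partial> i F ((x + h *\<^sub>R axis j 1) + s *\<^sub>R axis i 1)
      - \<partial> i F (x + s *\<^sub>R axis i 1)) (at s)" if "0 \<le> s" "s \<le> h" for s
    unfolding \<phi>_def using diff(1) [of s h] diff(1) [of s 0] that h
    by (intro DERIV_diff has_real_derivative_axis) (simp_all add: add_ac)
  from MVT2 [OF h(1) this] obtain \<xi> where \<xi>: "0 < \<xi>" "\<xi> < h"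
    "\<phi> h - \<phi> 0 = h * (\<partial> i F ((x + h *\<^sub>R axis j 1) + \<xi> *\<^sub>R axis i 1) - \<partial> i F (x + \<xi> *\<^sub>R axis i 1))"
    by auto
  have "((\<lambda>t. \<partial> i F ((x + \<xi> *\<^sub>R axis i 1) + t *\<^sub>R axis j 1)) has_real_derivative
      \<partial> j (\<partial> i F) ((x + \<xi> *\<^sub>R axis i 1) + t *\<^sub>R axis j 1)) (at t)" if "0 \<le> t" "t \<le> h" for t
    using diff(2) [of \<xi> t] that \<xi> by (intro has_real_derivative_axis) auto
  from MVT2 [OF h(1) this] obtain \<eta> where \<eta>: "0 < \<eta>" "\<eta> < h"
    "\<partial> i F ((x + \<xi> *\<^sub>R axis i 1) + h *\<^sub>R axis j 1) - \<partial> i F (x + \<xi> *\<^sub>R axis i 1)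
      = h * \<partial> j (\<partial> i F) ((x + \<xi> *\<^sub>R axis i 1) + \<eta> *\<^sub>R axis j 1)"
    by auto
  have "\<phi> h - \<phi> 0 = h * h * \<partial> j (\<partial> i F) (x + \<xi> *\<^sub>R axis i 1 + \<eta> *\<^sub>R axis j 1)"
    using \<xi>(3) \<eta>(3) by (simp add: add_ac)
  then show ?thesis
    using \<xi>(1,2) \<eta>(1,2) by (intro exI [of _ \<xi>] exI [of _ \<eta>]) (simp add: \<phi>_def algebra_simps)
qed

lemma partial_deriv_commute:
  fixes F :: "real^'n::finite \<Rightarrow> real"
  assumes S: "open S" and F: "smooth_on S F" and x: "x \<in> S"
  shows "\<partial> i (\<partial> j F) x = \<partial> j (\<partial> i F) x"
proof (rule ccontr)
  assume neq: "\<not> ?thesis"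
  define e where "e = \<bar>\<partial> i (\<partial> j F) x - \<partial> j (\<partial> i F) x\<bar> / 2"
  have "e > 0" using neq by (simp add: e_def)
  have cont: "isCont (\<partial> a (\<partial> b F)) x" for a b
    using F x by (intro differentiable_imp_continuous_within smooth_on_differentiable [of S]
        smooth_on_partial_deriv)
  have "\<exists>d>0. \<forall>y. dist y x < d \<longrightarrow> dist (\<partial> a (\<partial> b F) y) (\<partial> a (\<partial> b F) x) < e" for a b
    using cont [of a b] \<open>e > 0\<close> unfolding continuous_at_eps_delta by blast
  then obtain d d' where d: "d > 0" "\<And>y. dist y x < d \<Longrightarrow> \<bar>\<partial> i (\<partial> j F) y - \<partial> i (\<partial> j F) x\<bar> < e"
    and d': "d' > 0" "\<And>y. dist y x < d' \<Longrightarrow> \<bar>\<partial> j (\<partial> i F) y - \<partial> j (\<partial> i F) x\<bar> < e"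
    unfolding dist_real_def by metis
  obtain r where r: "r > 0" "ball x r \<subseteq> S"
    using S x by (auto simp: open_contains_ball)
  define h where "h = min r (min d d') / 3"
  have h: "0 < h" "2 * h < r" "2 * h < d" "2 * h < d'"
    using r d d' by (auto simp: h_def)
  have near: "dist (x + s *\<^sub>R axis a 1 + t *\<^sub>R axis b 1) x < 2 * h"
    if "0 < s" "s < h" "0 < t" "t < h" for s t a b
    using norm_triangle_ineq [of "s *\<^sub>R axis a (1::real)" "t *\<^sub>R axis b 1"] that
    by (simp add: dist_norm add.assoc)
  obtain s t where 1: "0 < s" "s < h" "0 < t" "t < h"
    "F (x + h *\<^sub>R axis i 1 + h *\<^sub>R axis j 1) - F (x + h *\<^sub>R axis i 1) - F (x + h *\<^sub>R axis j 1) + F x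
      = h * h * \<partial> j (\<partial> i F) (x + s *\<^sub>R axis i 1 + t *\<^sub>R axis j 1)"
    using second_difference_quotient [OF F r(2) h(1,2)] by blast
  obtain s' t' where 2: "0 < s'" "s' < h" "0 < t'" "t' < h"
    "F (x + h *\<^sub>R axis j 1 + h *\<^sub>R axis i 1) - F (x + h *\<^sub>R axis j 1) - F (x + h *\<^sub>R axis i 1) + F x
      = h * h * \<partial> i (\<partial> j F) (x + s' *\<^sub>R axis j 1 + t' *\<^sub>R axis i 1)"
    using second_difference_quotient [OF F r(2) h(1,2)] by blast
  have "h * h * \<partial> j (\<partial> i F) (x + s *\<^sub>R axis i 1 + t *\<^sub>R axis j 1)
      = h * h * \<partial> i (\<partial> j F) (x + s' *\<^sub>R axis j 1 + t' *\<^sub>R axis i 1)"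
    using 1(5) 2(5) by (simp add: algebra_simps)
  then have "\<partial> j (\<partial> i F) (x + s *\<^sub>R axis i 1 + t *\<^sub>R axis j 1)
      = \<partial> i (\<partial> j F) (x + s' *\<^sub>R axis j 1 + t' *\<^sub>R axis i 1)"
    using h(1) by simp
  moreover have "\<bar>\<partial> j (\<partial> i F) (x + s *\<^sub>R axis i 1 + t *\<^sub>R axis j 1) - \<partial> j (\<partial> i F) x\<bar> < e"
    using near [OF 1(1-4), of i j] h by (intro d'(2)) auto
  moreover have "\<bar>\<partial> i (\<partial> j F) (x + s' *\<^sub>R axis j 1 + t' *\<^sub>R axis i 1) - \<partial> i (\<partial> j F) x\<bar> < e"
    using near [OF 2(1-4), of j i] h by (intro d(2)) auto
  ultimately show False
    by (simp add: e_def abs_if split: if_splits)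
qed

lemma second_partial_mult:
  assumes S: "open S" and x: "x \<in> S" and F: "smooth_on S F" and H: "smooth_on S H"
  shows "\<partial> l (\<partial> i (\<lambda>y. F y * H y)) x = \<partial> l (\<partial> i F) x * H x + \<partial> i F x * \<partial> l H x
    + \<partial> l F x * \<partial> i H x + F x * \<partial> l (\<partial> i H) x"
proof -
  note d = smooth_on_differentiable [OF F] smooth_on_differentiable [OF H]
    smooth_on_differentiable [OF smooth_on_partial_deriv [OF F]]
    smooth_on_differentiable [OF smooth_on_partial_deriv [OF H]]
  have "\<partial> l (\<partial> i (\<lambda>y. F y * H y)) x = \<partial> l (\<lambda>y. \<partial> i F y * H y + F y * \<partial> i H y) x"
    by (rule partial_deriv_cong [OF S x]) (simp add: partial_deriv_mult d)
  then show ?thesis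
    using x by (simp add: partial_deriv_add partial_deriv_mult d)
qed

lemma second_partial_add:
  assumes S: "open S" and x: "x \<in> S" and F: "smooth_on S F" and H: "smooth_on S H"
  shows "\<partial> l (\<partial> i (\<lambda>y. F y + H y)) x = \<partial> l (\<partial> i F) x + \<partial> l (\<partial> i H) x"
proof -
  note d = smooth_on_differentiable [OF F] smooth_on_differentiable [OF H]
    smooth_on_differentiable [OF smooth_on_partial_deriv [OF F]]
    smooth_on_differentiable [OF smooth_on_partial_deriv [OF H]]
  have "\<partial> l (\<partial> i (\<lambda>y. F y + H y)) x = \<partial> l (\<lambda>y. \<partial> i F y + \<partial> i H y) x"
    by (rule partial_deriv_cong [OF S x]) (simp add: partial_deriv_add d)
  then show ?thesis
    using x by (simp add: partial_deriv_add d)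
qed

lemma second_partial_diff:
  assumes S: "open S" and x: "x \<in> S" and F: "smooth_on S F" and H: "smooth_on S H"
  shows "\<partial> l (\<partial> i (\<lambda>y. F y - H y)) x = \<partial> l (\<partial> i F) x - \<partial> l (\<partial> i H) x"
proof -
  note d = smooth_on_differentiable [OF F] smooth_on_differentiable [OF H]
    smooth_on_differentiable [OF smooth_on_partial_deriv [OF F]]
    smooth_on_differentiable [OF smooth_on_partial_deriv [OF H]]
  have "\<partial> l (\<partial> i (\<lambda>y. F y - H y)) x = \<partial> l (\<lambda>y. \<partial> i F y - \<partial> i H y) x"
    by (rule partial_deriv_cong [OF S x]) (simp add: partial_deriv_diff d)
  then show ?thesis
    using x by (simp add: partial_deriv_diff d)
qed

lemma second_partial_sum:
  assumes S: "open S" and x: "x \<in> S" and F: "\<And>a. smooth_on S (F a)"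
  shows "\<partial> l (\<partial> i (\<lambda>y. \<Sum>a\<in>I. F a y)) x = (\<Sum>a\<in>I. \<partial> l (\<partial> i (F a)) x)"
proof -
  note d = smooth_on_differentiable [OF F]
    smooth_on_differentiable [OF smooth_on_partial_deriv [OF F]]
  have "\<partial> l (\<partial> i (\<lambda>y. \<Sum>a\<in>I. F a y)) x = \<partial> l (\<lambda>y. \<Sum>a\<in>I. \<partial> i (F a) y) x"
    by (rule partial_deriv_cong [OF S x]) (simp add: partial_deriv_sum d)
  then show ?thesis
    using x by (simp add: partial_deriv_sum d)
qed

lemma second_partial_cong:
  assumes S: "open S" and x: "x \<in> S" and eq: "\<And>y. y \<in> S \<Longrightarrow> F y = H y"
  shows "\<partial> l (\<partial> i F) x = \<partial> l (\<partial> i H) x"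
  by (intro partial_deriv_cong [OF S] x eq)

section \<open>Metrics on open subsets of Euclidean space\<close>

locale coord_metric =
  fixes S :: "(real^'n::finite) set" and G :: "real^'n \<Rightarrow> real^'n^'n"
  assumes open_S: "open S"
    and smooth_G: "smooth_on S (\<lambda>x. G x $ i $ j)"
    and sym_G: "x \<in> S \<Longrightarrow> transpose (G x) = G x"
    and pos_G: "x \<in> S \<Longrightarrow> v \<noteq> 0 \<Longrightarrow> v \<bullet> (G x *v v) > 0"
begin

lemma G_commute: "x \<in> S \<Longrightarrow> G x $ i $ j = G x $ j $ i"
  using arg_cong [OF sym_G [of x], of "\<lambda>M. M $ j $ i"] by (simp add: transpose_def)

lemma partial_G_commute: "x \<in> S \<Longrightarrow> \<partial> k (\<lambda>y. G y $ i $ j) x = \<partial> k (\<lambda>y. G y $ j $ i) x"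
  by (rule partial_deriv_cong [OF open_S _ G_commute])

lemma invertible_G:
  assumes "x \<in> S" shows "invertible (G x)"
proof -
  have "G x *v v = 0 \<longrightarrow> v = 0" for v
    using pos_G [OF assms, of v] by (cases "v = 0") auto
  then show ?thesis
    by (simp add: invertible_left_inverse matrix_left_invertible_ker)
qed

lemma G_inv_sum:
  assumes "x \<in> S"
  shows "(\<Sum>k\<in>UNIV. G x $ i $ k * matrix_inv (G x) $ k $ j) = (if i = j then 1 else 0)"
  using arg_cong [OF invertible_matrix_inv(1) [OF invertible_G [OF assms]], of "\<lambda>M. M $ i $ j"]
  by (simp add: matrix_matrix_mult_def mat_def)

lemma smooth_G_inv: "smooth_on S (\<lambda>x. matrix_inv (G x) $ i $ j)"
  by (intro smooth_on_matrix_inv open_S smooth_G invertible_G)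

lemma smooth_partial_G: "smooth_on S (\<partial> k (\<lambda>x. G x $ i $ j))"
  by (intro smooth_on_partial_deriv smooth_G)

lemma smooth_christoffel: "smooth_on S (christoffel G k i j)"
  unfolding christoffel_def [abs_def]
  by (intro smooth_on_divide_numeral smooth_on_sum smooth_on_mult smooth_on_diff smooth_on_add
      smooth_G_inv smooth_partial_G open_S finite)

lemma smooth_riemann: "smooth_on S (riemann G l k i j)"
  unfolding riemann_def [abs_def]
  by (intro smooth_on_sum smooth_on_mult smooth_on_diff smooth_on_add
      smooth_christoffel smooth_on_partial_deriv open_S finite)

lemma smooth_ricci: "smooth_on S (ricci G j k)"
  unfolding ricci_def [abs_def] by (intro smooth_on_sum smooth_riemann open_S finite)

lemma smooth_scalar_coord: "smooth_on S (scalar_coord G)"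
  unfolding scalar_coord_def [abs_def]
  by (intro smooth_on_sum smooth_on_mult smooth_G_inv smooth_ricci open_S finite)

lemma christoffel_commute: "x \<in> S \<Longrightarrow> christoffel G k i j x = christoffel G k j i x"
  unfolding christoffel_def using partial_G_commute [of x _ i j] by (simp add: add.commute)

text \<open>With the index lowered the inverse of the metric disappears. Derivatives of the Christoffel
  symbols are therefore computed from this identity rather than from the definition.\<close>

lemma christoffel_lowered:
  assumes x: "x \<in> S"
  shows "(\<Sum>k\<in>UNIV. G x $ l $ k * christoffel G k i j x) =
    (\<partial> i (\<lambda>y. G y $ j $ l) x + \<partial> j (\<lambda>y. G y $ i $ l) x - \<partial> l (\<lambda>y. G y $ i $ j) x) / 2"
proof -
  define T where "T m = (\<partial> i (\<lambda>y. G y $ j $ m) x + \<partial> j (\<lambda>y. G y $ i $ m) x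
    - \<partial> m (\<lambda>y. G y $ i $ j) x) / 2" for m
  have "(\<Sum>k\<in>UNIV. G x $ l $ k * christoffel G k i j x)
      = (\<Sum>k\<in>UNIV. \<Sum>m\<in>UNIV. G x $ l $ k * matrix_inv (G x) $ k $ m * T m)"
    by (simp add: christoffel_def T_def sum_distrib_left sum_divide_distrib mult.assoc)
  also have "\<dots> = (\<Sum>m\<in>UNIV. (\<Sum>k\<in>UNIV. G x $ l $ k * matrix_inv (G x) $ k $ m) * T m)"
    by (subst sum.swap) (simp add: sum_distrib_right)
  also have "\<dots> = (\<Sum>m\<in>UNIV. if l = m then T m else 0)"
    by (intro sum.cong) (auto simp: G_inv_sum [OF x])
  finally show ?thesis by (simp add: T_def)
qed

lemma metric_compatible:
  assumes x: "x \<in> S"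
  shows "\<partial> k (\<lambda>y. G y $ i $ j) x =
    (\<Sum>l\<in>UNIV. G x $ j $ l * christoffel G l k i x) + (\<Sum>l\<in>UNIV. G x $ i $ l * christoffel G l k j x)"
  unfolding christoffel_lowered [OF x]
  using partial_G_commute [OF x] by (simp add: field_simps)

end

section \<open>Naturality under changes of coordinates\<close>

lemma jacobian_nth:
  fixes \<phi> :: "real^'m::finite \<Rightarrow> real^'n::finite"
  assumes "\<And>a. (\<lambda>y. \<phi> y $ a) differentiable (at x)"
  shows "jacobian \<phi> (at x) $ a $ i = \<partial> i (\<lambda>y. \<phi> y $ a) x"
proof -
  have "frechet_derivative \<phi> (at x) = (\<lambda>v. \<chi> a. \<Sum>i\<in>UNIV. v $ i * \<partial> i (\<lambda>y. \<phi> y $ a) x)"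
    using frechet_derivative_at [OF has_derivative_vec_partial_deriv [OF assms]] by simp
  then show ?thesis
    by (simp add: jacobian_def matrix_def sum_axis)
qed

lemma sum3_rotate:
  "(\<Sum>a\<in>A. \<Sum>b\<in>B. \<Sum>c\<in>C. f a b c) = (\<Sum>c\<in>C. \<Sum>a\<in>A. \<Sum>b\<in>B. f a b c)"
  by (simp add: sum.swap [of _ C])

definition matrix_partial :: "'n::finite \<Rightarrow> (real^'n \<Rightarrow> real^'k^'m) \<Rightarrow> real^'n \<Rightarrow> real^'k^'m" where
  "matrix_partial i M x = (\<chi> a b. \<partial> i (\<lambda>y. M y $ a $ b) x)"

lemma matrix_partial_mult:
  assumes "\<And>a b. (\<lambda>y. M y $ a $ b) differentiable (at x)" "\<And>a b. (\<lambda>y. N y $ a $ b) differentiable (at x)"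
  shows "matrix_partial i (\<lambda>y. M y ** N y) x = matrix_partial i M x ** N x + M x ** matrix_partial i N x"
proof -
  have "\<partial> i (\<lambda>y. \<Sum>c\<in>UNIV. M y $ a $ c * N y $ c $ b) x =
    (\<Sum>c\<in>UNIV. \<partial> i (\<lambda>y. M y $ a $ c) x * N x $ c $ b + M x $ a $ c * \<partial> i (\<lambda>y. N y $ c $ b) x)" for a b
    using assms by (subst partial_deriv_sum) (auto simp: partial_deriv_mult)
  then show ?thesis
    by (simp add: vec_eq_iff matrix_partial_def matrix_matrix_mult_def sum.distrib)
qed

lemma matrix_partial_add:
  assumes "\<And>a b. (\<lambda>y. M y $ a $ b) differentiable (at x)" "\<And>a b. (\<lambda>y. N y $ a $ b) differentiable (at x)"
  shows "matrix_partial i (\<lambda>y. M y + N y) x = matrix_partial i M x + matrix_partial i N x"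
  using assms by (simp add: vec_eq_iff matrix_partial_def partial_deriv_add)

lemma matrix_partial_cong:
  assumes "open S" "x \<in> S" "\<And>y. y \<in> S \<Longrightarrow> M y = N y"
  shows "matrix_partial i M x = matrix_partial i N x"
proof -
  have "\<partial> i (\<lambda>y. M y $ a $ b) x = \<partial> i (\<lambda>y. N y $ a $ b) x" for a b
    by (rule partial_deriv_cong [OF assms(1,2)]) (simp add: assms(3))
  then show ?thesis by (simp add: matrix_partial_def)
qed

lemma matrix_mult_distribs:
  fixes A B :: "real^'n::finite^'m::finite"
  shows "(A + B) ** C = A ** C + B ** C" "(A - B) ** C = A ** C - B ** C"
    "D ** (A + B) = D ** A + D ** B" "D ** (A - B) = D ** A - D ** B"
  by (simp_all add: vec_eq_iff matrix_matrix_mult_def sum.distrib sum_subtractf algebra_simps)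

lemma matrix_sum_mult:
  fixes X :: "'c \<Rightarrow> real^'n::finite^'m::finite"
  shows "(\<Sum>c\<in>I. X c) ** M = (\<Sum>c\<in>I. X c ** M)"
proof (induction I rule: infinite_finite_induct)
  case (insert c I)
  then show ?case by (simp add: matrix_mult_distribs)
qed (simp_all add: vec_eq_iff matrix_matrix_mult_def)

text \<open>The Levi-Civita connection as a matrix valued 1-form \<open>\<Gamma>\<close>. Its curvature form is
  \<open>d\<Gamma> + \<Gamma> \<and> \<Gamma>\<close>.\<close>

definition connection_matrix ::
  "(real^'n \<Rightarrow> real^'n^'n) \<Rightarrow> 'n::finite \<Rightarrow> real^'n \<Rightarrow> real^'n^'n" where
  "connection_matrix G i x = (\<chi> k j. christoffel G k i j x)"

definition curvature_matrix ::
  "(real^'n \<Rightarrow> real^'n^'n) \<Rightarrow> 'n::finite \<Rightarrow> 'n \<Rightarrow> real^'n \<Rightarrow> real^'n^'n" where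
  "curvature_matrix G i j x =
     matrix_partial i (connection_matrix G j) x - matrix_partial j (connection_matrix G i) x
     + connection_matrix G i x ** connection_matrix G j x
     - connection_matrix G j x ** connection_matrix G i x"

lemma curvature_matrix_nth: "curvature_matrix G i j x $ l $ k = riemann G l k i j x"
  by (simp add: curvature_matrix_def riemann_def matrix_partial_def connection_matrix_def
      matrix_matrix_mult_def sum_subtractf)

text \<open>A local isometry in coordinates. It may fail to be injective, so that the notion covers both the
  transition maps of an atlas and the quadratic maps that produce normal coordinates.\<close>

locale metric_pullback = src: coord_metric S G + tgt: coord_metric T H
  for S :: "(real^'n::finite) set" and G T H +
  fixes \<phi> :: "real^'n \<Rightarrow> real^'n"
  assumes smooth_\<phi>: "smooth_on S (\<lambda>x. \<phi> x $ a)"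
    and \<phi>_mem: "x \<in> S \<Longrightarrow> \<phi> x \<in> T"
    and pullback: "x \<in> S \<Longrightarrow> G x = transpose (jacobian \<phi> (at x)) ** H (\<phi> x) ** jacobian \<phi> (at x)"
begin

abbreviation D :: "'n \<Rightarrow> 'n \<Rightarrow> real^'n \<Rightarrow> real" where
  "D a i \<equiv> \<partial> i (\<lambda>y. \<phi> y $ a)"

definition J :: "real^'n \<Rightarrow> real^'n^'n" where
  "J x = (\<chi> a i. D a i x)"

lemma J_nth: "J x $ a $ i = D a i x"
  by (simp add: J_def)

lemma differentiable_\<phi>: "x \<in> S \<Longrightarrow> (\<lambda>y. \<phi> y $ a) differentiable (at x)"
  by (rule smooth_on_differentiable [OF smooth_\<phi>])

lemma smooth_D: "smooth_on S (D a i)"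
  by (rule smooth_on_partial_deriv [OF smooth_\<phi>])

lemma jacobian_eq_J: "x \<in> S \<Longrightarrow> jacobian \<phi> (at x) = J x"
  by (simp add: vec_eq_iff J_nth jacobian_nth differentiable_\<phi>)

lemma pullback_J: "x \<in> S \<Longrightarrow> G x = transpose (J x) ** H (\<phi> x) ** J x"
  by (simp add: pullback jacobian_eq_J)

lemma pullback_nth:
  assumes "x \<in> S"
  shows "G x $ i $ j = (\<Sum>a\<in>UNIV. \<Sum>b\<in>UNIV. D a i x * (H (\<phi> x) $ a $ b * D b j x))"
proof -
  have "G x $ i $ j = (\<Sum>b\<in>UNIV. (\<Sum>a\<in>UNIV. D a i x * H (\<phi> x) $ a $ b) * D b j x)"
    unfolding pullback_J [OF assms] by (simp add: matrix_matrix_mult_def transpose_def J_nth)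
  also have "\<dots> = (\<Sum>b\<in>UNIV. \<Sum>a\<in>UNIV. D a i x * (H (\<phi> x) $ a $ b * D b j x))"
    by (simp add: sum_distrib_right mult.assoc)
  finally show ?thesis by (subst sum.swap)
qed

lemma invertible_J:
  assumes "x \<in> S" shows "invertible (J x)"
proof -
  have "J x *v v = 0 \<longrightarrow> v = 0" for v
    using src.pos_G [OF assms, of v] unfolding pullback_J [OF assms]
    by (cases "v = 0") (auto simp: matrix_vector_mul_assoc [symmetric])
  then show ?thesis
    by (simp add: invertible_left_inverse matrix_left_invertible_ker)
qed

lemma smooth_compose: "smooth_on T F \<Longrightarrow> smooth_on S (\<lambda>x. F (\<phi> x))"
  by (rule smooth_on_compose [OF src.open_S _ smooth_\<phi> \<phi>_mem])

lemma partial_compose: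
  assumes "x \<in> S" "smooth_on T F"
  shows "\<partial> i (\<lambda>y. F (\<phi> y)) x = (\<Sum>a\<in>UNIV. D a i x * \<partial> a F (\<phi> x))"
  using assms by (intro partial_deriv_chain differentiable_\<phi> smooth_on_differentiable [of T F] \<phi>_mem)

lemma partial_pullback:
  assumes x: "x \<in> S"
  shows "\<partial> k (\<lambda>y. G y $ i $ j) x =
    (\<Sum>a\<in>UNIV. \<Sum>b\<in>UNIV. \<partial> k (D a i) x * (H (\<phi> x) $ a $ b * D b j x))
    + (\<Sum>a\<in>UNIV. \<Sum>b\<in>UNIV. \<partial> k (D a j) x * (H (\<phi> x) $ a $ b * D b i x))
    + (\<Sum>a\<in>UNIV. \<Sum>b\<in>UNIV. \<Sum>c\<in>UNIV. D a i x * D b j x * D c k x * \<partial> c (\<lambda>y. H y $ a $ b) (\<phi> x))"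
proof -
  have dH: "(\<lambda>y. H (\<phi> y) $ a $ b) differentiable (at x)" for a b
    by (rule smooth_on_differentiable [OF smooth_compose [OF tgt.smooth_G] x])
  have dD: "D a i differentiable (at x)" for a i
    by (rule smooth_on_differentiable [OF smooth_D x])
  have "\<partial> k (\<lambda>y. G y $ i $ j) x
      = \<partial> k (\<lambda>y. \<Sum>a\<in>UNIV. \<Sum>b\<in>UNIV. D a i y * (H (\<phi> y) $ a $ b * D b j y)) x"
    by (rule partial_deriv_cong [OF src.open_S x pullback_nth])
  also have "\<dots> = (\<Sum>a\<in>UNIV. \<Sum>b\<in>UNIV. \<partial> k (D a i) x * (H (\<phi> x) $ a $ b * D b j x)
      + D a i x * ((\<Sum>c\<in>UNIV. D c k x * \<partial> c (\<lambda>y. H y $ a $ b) (\<phi> x)) * D b j x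
      + H (\<phi> x) $ a $ b * \<partial> k (D b j) x))"
    using dH dD
    by (simp add: partial_deriv_sum partial_deriv_mult partial_compose [OF x tgt.smooth_G])
  also have "\<dots> = (\<Sum>a\<in>UNIV. \<Sum>b\<in>UNIV. \<partial> k (D a i) x * (H (\<phi> x) $ a $ b * D b j x))
    + (\<Sum>a\<in>UNIV. \<Sum>b\<in>UNIV. \<partial> k (D b j) x * (H (\<phi> x) $ b $ a * D a i x))
    + (\<Sum>a\<in>UNIV. \<Sum>b\<in>UNIV. \<Sum>c\<in>UNIV. D a i x * D b j x * D c k x * \<partial> c (\<lambda>y. H y $ a $ b) (\<phi> x))"
    using tgt.G_commute [OF \<phi>_mem [OF x]]
    by (simp add: sum.distrib sum_distrib_left sum_distrib_right algebra_simps)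
  also have "(\<Sum>a\<in>UNIV. \<Sum>b\<in>UNIV. \<partial> k (D b j) x * (H (\<phi> x) $ b $ a * D a i x))
      = (\<Sum>a\<in>UNIV. \<Sum>b\<in>UNIV. \<partial> k (D a j) x * (H (\<phi> x) $ a $ b * D b i x))"
    by (rule sum.swap)
  finally show ?thesis .
qed

lemma second_D_commute: "x \<in> S \<Longrightarrow> \<partial> k (D a i) x = \<partial> i (D a k) x"
  by (rule partial_deriv_commute [OF src.open_S smooth_\<phi>])

text \<open>The metric \<open>H\<close> is nondegenerate, and the coordinate fields pushed forward by \<open>\<phi>\<close> form a basis.\<close>

lemma transpose_J_inj:
  assumes x: "x \<in> S"
    and eq: "\<And>l. (\<Sum>b\<in>UNIV. D b l x * (\<Sum>d\<in>UNIV. H (\<phi> x) $ b $ d * u d))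
      = (\<Sum>b\<in>UNIV. D b l x * (\<Sum>d\<in>UNIV. H (\<phi> x) $ b $ d * w d))"
  shows "u d = w d"
proof -
  define z where "z = (\<chi> d. u d - w d)"
  have "transpose (J x) *v (H (\<phi> x) *v z) = 0"
    using eq by (simp add: vec_eq_iff matrix_vector_mult_def transpose_def J_nth z_def
        right_diff_distrib sum_subtractf del: transpose_matrix_vector)
  moreover have "invertible (transpose (J x) ** H (\<phi> x))"
    by (intro invertible_mult transpose_invertible invertible_J tgt.invertible_G \<phi>_mem x)
  ultimately have "z = 0"
    unfolding matrix_vector_mul_assoc
    by (metis invertible_left_inverse matrix_left_invertible_ker)
  then show ?thesis by (simp add: z_def vec_eq_iff)
qed

text \<open>Both sides are compared after lowering the index. In the Koszul formula for the pulled back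
  metric, the terms with second derivatives of \<open>\<phi>\<close> occur in six copies \<open>A\<close>, of which four cancel
  because second derivatives commute; the terms with first derivatives of \<open>H\<close> are the Koszul formula
  for \<open>H\<close>.\<close>

lemma christoffel_pullback:
  assumes x: "x \<in> S"
  shows "(\<Sum>k\<in>UNIV. D d k x * christoffel G k i j x) =
    \<partial> i (D d j) x + (\<Sum>a\<in>UNIV. \<Sum>b\<in>UNIV. D a i x * D b j x * christoffel H d a b (\<phi> x))"
proof (rule transpose_J_inj [OF x])
  fix l
  define A where "A k i j = (\<Sum>a\<in>UNIV. \<Sum>b\<in>UNIV. \<partial> k (D a i) x * (H (\<phi> x) $ a $ b * D b j x))" for k i j
  define P where "P c a b = \<partial> c (\<lambda>y. H y $ a $ b) (\<phi> x)" for c a b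
  define M where "M k i j = (\<Sum>a\<in>UNIV. \<Sum>b\<in>UNIV. \<Sum>c\<in>UNIV. D a i x * D b j x * D c k x * P c a b)" for k i j
  have pG: "\<partial> k (\<lambda>y. G y $ i $ j) x = A k i j + A k j i + M k i j" for k i j
    by (simp add: partial_pullback [OF x] A_def M_def P_def)
  have A_commute: "A k i j = A i k j" for k i j
    using second_D_commute [OF x] by (simp add: A_def)
  have M1: "M i j l = (\<Sum>a\<in>UNIV. \<Sum>b\<in>UNIV. \<Sum>c\<in>UNIV. D a i x * D b j x * D c l x * P a b c)"
    unfolding M_def by (subst sum3_rotate) (simp add: mult_ac)
  have M2: "M j i l = (\<Sum>a\<in>UNIV. \<Sum>b\<in>UNIV. \<Sum>c\<in>UNIV. D a i x * D b j x * D c l x * P b a c)"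
    unfolding M_def by (subst (2) sum.swap) (simp add: mult_ac)
  have "(\<Sum>b\<in>UNIV. D b l x * (\<Sum>d\<in>UNIV. H (\<phi> x) $ b $ d * (\<Sum>k\<in>UNIV. D d k x * christoffel G k i j x)))
      = (\<Sum>b\<in>UNIV. \<Sum>d\<in>UNIV. \<Sum>k\<in>UNIV. D b l x * (H (\<phi> x) $ b $ d * (D d k x * christoffel G k i j x)))"
    by (simp add: sum_distrib_left)
  also have "\<dots> = (\<Sum>k\<in>UNIV. \<Sum>b\<in>UNIV. \<Sum>d\<in>UNIV. D b l x * (H (\<phi> x) $ b $ d * (D d k x * christoffel G k i j x)))"
    by (rule sum3_rotate)
  also have "\<dots> = (\<Sum>k\<in>UNIV. G x $ l $ k * christoffel G k i j x)"
    by (simp add: pullback_nth [OF x] sum_distrib_right mult.assoc)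
  also have "\<dots> = (A i j l + A i l j + M i j l + (A j i l + A j l i + M j i l)
      - (A l i j + A l j i + M l i j)) / 2"
    by (simp add: src.christoffel_lowered [OF x] pG)
  also have "\<dots> = A i j l + (M i j l + M j i l - M l i j) / 2"
    using A_commute [of i l j] A_commute [of j l i] A_commute [of i j l] by (simp add: field_simps)
  also have "(M i j l + M j i l - M l i j) / 2 = (\<Sum>a\<in>UNIV. \<Sum>b\<in>UNIV. \<Sum>c\<in>UNIV.
      D a i x * D b j x * D c l x * (P a b c + P b a c - P c a b)) / 2"
    by (simp add: M1 M2) (simp add: M_def sum.distrib sum_subtractf ring_distribs)
  also have "\<dots> = (\<Sum>a\<in>UNIV. \<Sum>b\<in>UNIV. \<Sum>c\<in>UNIV.
      D a i x * D b j x * D c l x * ((P a b c + P b a c - P c a b) / 2))"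
    by (simp add: sum_divide_distrib)
  also have "\<dots> = (\<Sum>a\<in>UNIV. \<Sum>b\<in>UNIV. \<Sum>c\<in>UNIV.
      D a i x * D b j x * D c l x * (\<Sum>d\<in>UNIV. H (\<phi> x) $ c $ d * christoffel H d a b (\<phi> x)))"
    by (simp add: tgt.christoffel_lowered [OF \<phi>_mem [OF x]] P_def)
  finally have eq: "(\<Sum>b\<in>UNIV. D b l x * (\<Sum>d\<in>UNIV. H (\<phi> x) $ b $ d * (\<Sum>k\<in>UNIV. D d k x * christoffel G k i j x)))
    = A i j l + (\<Sum>a\<in>UNIV. \<Sum>b\<in>UNIV. \<Sum>c\<in>UNIV.
      D a i x * D b j x * D c l x * (\<Sum>d\<in>UNIV. H (\<phi> x) $ c $ d * christoffel H d a b (\<phi> x)))" .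
  have A_eq: "A i j l = (\<Sum>b\<in>UNIV. D b l x * (\<Sum>d\<in>UNIV. H (\<phi> x) $ b $ d * \<partial> i (D d j) x))"
    unfolding A_def using tgt.G_commute [OF \<phi>_mem [OF x]]
    by (subst sum.swap) (simp add: sum_distrib_left mult_ac)
  have "(\<Sum>a\<in>UNIV. \<Sum>b\<in>UNIV. \<Sum>c\<in>UNIV.
      D a i x * D b j x * D c l x * (\<Sum>d\<in>UNIV. H (\<phi> x) $ c $ d * christoffel H d a b (\<phi> x)))
    = (\<Sum>c\<in>UNIV. \<Sum>d\<in>UNIV. \<Sum>a\<in>UNIV. \<Sum>b\<in>UNIV.
      D a i x * D b j x * D c l x * (H (\<phi> x) $ c $ d * christoffel H d a b (\<phi> x)))"
    unfolding sum_distrib_left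
    by (subst sum3_rotate, rule sum.cong [OF refl sum3_rotate])
  also have "\<dots> = (\<Sum>c\<in>UNIV. D c l x * (\<Sum>d\<in>UNIV. H (\<phi> x) $ c $ d *
      (\<Sum>a\<in>UNIV. \<Sum>b\<in>UNIV. D a i x * D b j x * christoffel H d a b (\<phi> x))))"
    by (simp add: sum_distrib_left mult_ac)
  finally show "(\<Sum>b\<in>UNIV. D b l x * (\<Sum>d\<in>UNIV. H (\<phi> x) $ b $ d * (\<Sum>k\<in>UNIV. D d k x * christoffel G k i j x)))
    = (\<Sum>b\<in>UNIV. D b l x * (\<Sum>d\<in>UNIV. H (\<phi> x) $ b $ d *
      (\<partial> i (D d j) x + (\<Sum>a\<in>UNIV. \<Sum>b\<in>UNIV. D a i x * D b j x * christoffel H d a b (\<phi> x)))))"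
    unfolding eq A_eq by (simp add: ring_distribs sum.distrib)
qed

text \<open>The second derivatives of \<open>\<phi>\<close> that the chain rule produces are exactly the inhomogeneous term in
  the transformation law of the Christoffel symbols.\<close>

lemma hessian_pullback:
  assumes x: "x \<in> S" and F: "smooth_on T F"
  shows "hessian G (\<lambda>y. F (\<phi> y)) i j x =
    (\<Sum>a\<in>UNIV. \<Sum>b\<in>UNIV. D a i x * D b j x * hessian H F a b (\<phi> x))"
proof -
  have dF: "(\<lambda>y. \<partial> b F (\<phi> y)) differentiable (at x)" for b
    by (rule smooth_on_differentiable [OF smooth_compose [OF smooth_on_partial_deriv [OF F]] x])
  have dD: "D a i differentiable (at x)" for a i
    by (rule smooth_on_differentiable [OF smooth_D x])
  have "\<partial> i (\<partial> j (\<lambda>y. F (\<phi> y))) x = \<partial> i (\<lambda>y. \<Sum>b\<in>UNIV. D b j y * \<partial> b F (\<phi> y)) x"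
    by (rule partial_deriv_cong [OF src.open_S x partial_compose [OF _ F]])
  also have "\<dots> = (\<Sum>b\<in>UNIV. \<partial> i (D b j) x * \<partial> b F (\<phi> x)
      + D b j x * (\<Sum>a\<in>UNIV. D a i x * \<partial> a (\<partial> b F) (\<phi> x)))"
    using dF dD
    by (simp add: partial_deriv_sum partial_deriv_mult partial_compose [OF x smooth_on_partial_deriv [OF F]])
  finally have 1: "\<partial> i (\<partial> j (\<lambda>y. F (\<phi> y))) x = (\<Sum>d\<in>UNIV. \<partial> i (D d j) x * \<partial> d F (\<phi> x))
      + (\<Sum>a\<in>UNIV. \<Sum>b\<in>UNIV. D a i x * D b j x * \<partial> a (\<partial> b F) (\<phi> x))"
    by (subst sum.swap) (simp add: sum.distrib sum_distrib_left mult_ac)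
  have "(\<Sum>k\<in>UNIV. christoffel G k i j x * \<partial> k (\<lambda>y. F (\<phi> y)) x)
      = (\<Sum>k\<in>UNIV. \<Sum>d\<in>UNIV. D d k x * christoffel G k i j x * \<partial> d F (\<phi> x))"
    by (simp add: partial_compose [OF x F] sum_distrib_left mult_ac)
  also have "\<dots> = (\<Sum>d\<in>UNIV. (\<Sum>k\<in>UNIV. D d k x * christoffel G k i j x) * \<partial> d F (\<phi> x))"
    by (subst sum.swap) (simp add: sum_distrib_right)
  also have "\<dots> = (\<Sum>d\<in>UNIV. \<partial> i (D d j) x * \<partial> d F (\<phi> x))
      + (\<Sum>d\<in>UNIV. \<Sum>a\<in>UNIV. \<Sum>b\<in>UNIV. D a i x * D b j x * (christoffel H d a b (\<phi> x) * \<partial> d F (\<phi> x)))"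
    unfolding christoffel_pullback [OF x]
    by (simp add: ring_distribs sum.distrib sum_distrib_right mult.assoc)
  also have "(\<Sum>d\<in>UNIV. \<Sum>a\<in>UNIV. \<Sum>b\<in>UNIV. D a i x * D b j x * (christoffel H d a b (\<phi> x) * \<partial> d F (\<phi> x)))
      = (\<Sum>a\<in>UNIV. \<Sum>b\<in>UNIV. D a i x * D b j x * (\<Sum>d\<in>UNIV. christoffel H d a b (\<phi> x) * \<partial> d F (\<phi> x)))"
    unfolding sum_distrib_left by (rule sum3_rotate [symmetric])
  finally show ?thesis
    unfolding hessian_def 1 by (simp add: right_diff_distrib sum_subtractf)
qed

lemma connection_matrix_pullback:
  assumes x: "x \<in> S"
  shows "J x ** connection_matrix G i x = matrix_partial i J x
    + (\<Sum>a\<in>UNIV. D a i x *\<^sub>R connection_matrix H a (\<phi> x)) ** J x"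
proof -
  have "(J x ** connection_matrix G i x) $ d $ j = (matrix_partial i J x
    + (\<Sum>a\<in>UNIV. D a i x *\<^sub>R connection_matrix H a (\<phi> x)) ** J x) $ d $ j" for d j
  proof -
    have "(\<Sum>a\<in>UNIV. \<Sum>b\<in>UNIV. D a i x * D b j x * christoffel H d a b (\<phi> x))
      = (\<Sum>b\<in>UNIV. (\<Sum>a\<in>UNIV. D a i x * christoffel H d a b (\<phi> x)) * D b j x)"
      by (subst sum.swap) (simp add: sum_distrib_left mult_ac)
    then show ?thesis
      using christoffel_pullback [OF x, of d i j]
      by (simp add: matrix_matrix_mult_def J_nth connection_matrix_def matrix_partial_def)
  qed
  then show ?thesis by (simp add: vec_eq_iff)
qed

text \<open>Curvature of a gauge transformed connection: with \<open>B\<close> the pulled back connection form,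
  \<open>J \<Gamma> = dJ + B J\<close>, and differentiating this once more turns \<open>\<Gamma>\<close> into \<open>B\<close> in the curvature
  because the terms with derivatives of \<open>J\<close> cancel.\<close>

lemma curvature_matrix_pullback:
  assumes x: "x \<in> S"
  shows "J x ** curvature_matrix G i j x =
    (\<Sum>c\<in>UNIV. \<Sum>a\<in>UNIV. (D c i x * D a j x) *\<^sub>R curvature_matrix H c a (\<phi> x)) ** J x"
proof -
  define B where "B i x = (\<Sum>a\<in>UNIV. D a i x *\<^sub>R connection_matrix H a (\<phi> x))" for i x
  define C where "C i = connection_matrix G i" for i
  define K where "K i = connection_matrix H i (\<phi> x)" for i
  have smooth_K: "smooth_on S (\<lambda>y. connection_matrix H a (\<phi> y) $ k $ l)" for a k l
    by (simp add: connection_matrix_def smooth_compose tgt.smooth_christoffel)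
  have smooth_B: "smooth_on S (\<lambda>y. B i y $ k $ l)" for i k l
    unfolding B_def sum_component vector_scaleR_component real_scaleR_def
    by (intro smooth_on_sum smooth_on_mult smooth_D smooth_K src.open_S finite)
  have smooth_C: "smooth_on S (\<lambda>y. C i y $ k $ l)" for i k l
    by (simp add: C_def connection_matrix_def src.smooth_christoffel)
  have smooth_J: "smooth_on S (\<lambda>y. J y $ k $ l)" for k l
    by (simp add: J_nth smooth_D)
  have smooth_pJ: "smooth_on S (\<lambda>y. matrix_partial i J y $ k $ l)" for i k l
    using smooth_on_partial_deriv [OF smooth_D] by (simp add: matrix_partial_def J_nth)
  note diff = smooth_on_differentiable [OF smooth_B x] smooth_on_differentiable [OF smooth_C x]
    smooth_on_differentiable [OF smooth_J x] smooth_on_differentiable [OF smooth_pJ x]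
  have gauge: "J y ** C i y = matrix_partial i J y + B i y ** J y" if "y \<in> S" for i y
    using connection_matrix_pullback [OF that] by (simp add: B_def C_def)
  have dgauge: "matrix_partial i J x ** C j x + J x ** matrix_partial i (C j) x
    = matrix_partial i (matrix_partial j J) x + (matrix_partial i (B j) x ** J x + B j x ** matrix_partial i J x)" for i j
  proof -
    have "matrix_partial i (\<lambda>y. J y ** C j y) x = matrix_partial i (\<lambda>y. matrix_partial j J y + B j y ** J y) x"
      by (rule matrix_partial_cong [OF src.open_S x gauge])
    moreover have "smooth_on S (\<lambda>y. (B j y ** J y) $ k $ l)" for k l
      unfolding matrix_matrix_mult_def vec_lambda_beta
      by (intro smooth_on_sum smooth_on_mult smooth_B smooth_J src.open_S finite)
    ultimately show ?thesis
      using diff smooth_on_differentiable [OF _ x]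
      by (simp add: matrix_partial_mult matrix_partial_add)
  qed
  have ddJ: "matrix_partial i (matrix_partial j J) x = matrix_partial j (matrix_partial i J) x"
    using partial_deriv_commute [OF src.open_S smooth_D x]
    by (simp add: matrix_partial_def J_nth)
  \<comment> \<open>The gauge equation is used twice, to move \<open>J\<close> past both factors.\<close>
  have CC: "J x ** (C i x ** C j x) = B i x ** (matrix_partial j J x + B j x ** J x) + matrix_partial i J x ** C j x" for i j
    by (simp add: matrix_mul_assoc gauge [OF x] matrix_mult_distribs)
      (simp add: matrix_mul_assoc [symmetric] gauge [OF x] matrix_mult_distribs)
  have "J x ** curvature_matrix G i j x = (J x ** matrix_partial i (C j) x - J x ** matrix_partial j (C i) x)
      + J x ** (C i x ** C j x) - J x ** (C j x ** C i x)"
    by (simp add: curvature_matrix_def C_def matrix_mult_distribs)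
  also have "\<dots> = (matrix_partial i (B j) x - matrix_partial j (B i) x
      + B i x ** B j x - B j x ** B i x) ** J x"
    unfolding CC using dgauge [of i j] dgauge [of j i] ddJ
    by (simp add: matrix_mult_distribs matrix_mul_assoc algebra_simps)
  also have "matrix_partial i (B j) x - matrix_partial j (B i) x + B i x ** B j x - B j x ** B i x
    = (\<Sum>c\<in>UNIV. \<Sum>a\<in>UNIV. (D c i x * D a j x) *\<^sub>R curvature_matrix H c a (\<phi> x))"
  proof -
    define P where "P c a = matrix_partial c (connection_matrix H a) (\<phi> x)" for c a
    have dB: "matrix_partial i (B j) x = (\<Sum>a\<in>UNIV. \<partial> i (D a j) x *\<^sub>R K a)
        + (\<Sum>c\<in>UNIV. \<Sum>a\<in>UNIV. (D c i x * D a j x) *\<^sub>R P c a)" for i j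
    proof -
      have "matrix_partial i (B j) x $ k $ l = ((\<Sum>a\<in>UNIV. \<partial> i (D a j) x *\<^sub>R K a)
        + (\<Sum>c\<in>UNIV. \<Sum>a\<in>UNIV. (D c i x * D a j x) *\<^sub>R P c a)) $ k $ l" for k l
      proof -
        have "matrix_partial i (B j) x $ k $ l = \<partial> i (\<lambda>y. \<Sum>a\<in>UNIV. D a j y * christoffel H k a l (\<phi> y)) x"
          by (simp add: matrix_partial_def B_def connection_matrix_def)
        also have "\<dots> = (\<Sum>a\<in>UNIV. \<partial> i (D a j) x * christoffel H k a l (\<phi> x)
          + D a j x * (\<Sum>c\<in>UNIV. D c i x * \<partial> c (christoffel H k a l) (\<phi> x)))"
          using smooth_on_differentiable [OF smooth_D x]
            smooth_on_differentiable [OF smooth_compose [OF tgt.smooth_christoffel] x]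
          by (simp add: partial_deriv_sum partial_deriv_mult partial_compose [OF x tgt.smooth_christoffel])
        also have "\<dots> = (\<Sum>a\<in>UNIV. \<partial> i (D a j) x * christoffel H k a l (\<phi> x))
          + (\<Sum>a\<in>UNIV. \<Sum>c\<in>UNIV. D c i x * D a j x * \<partial> c (christoffel H k a l) (\<phi> x))"
          by (simp add: sum.distrib sum_distrib_left mult_ac)
        also have "(\<Sum>a\<in>UNIV. \<Sum>c\<in>UNIV. D c i x * D a j x * \<partial> c (christoffel H k a l) (\<phi> x))
          = (\<Sum>c\<in>UNIV. \<Sum>a\<in>UNIV. D c i x * D a j x * \<partial> c (christoffel H k a l) (\<phi> x))"
          by (rule sum.swap)
        finally show ?thesis
          by (simp add: K_def P_def matrix_partial_def connection_matrix_def)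
      qed
      then show ?thesis by (simp add: vec_eq_iff)
    qed
    have BB: "B i x ** B j x = (\<Sum>c\<in>UNIV. \<Sum>a\<in>UNIV. (D c i x * D a j x) *\<^sub>R (K c ** K a))" for i j
    proof -
      have "(B i x ** B j x) $ k $ l = (\<Sum>c\<in>UNIV. \<Sum>a\<in>UNIV. (D c i x * D a j x) *\<^sub>R (K c ** K a)) $ k $ l" for k l
      proof -
        have "(B i x ** B j x) $ k $ l = (\<Sum>m\<in>UNIV. \<Sum>c\<in>UNIV. \<Sum>a\<in>UNIV.
            D c i x * D a j x * (K c $ k $ m * K a $ m $ l))"
          by (simp add: B_def K_def matrix_matrix_mult_def sum_product mult_ac)
        also have "\<dots> = (\<Sum>c\<in>UNIV. \<Sum>a\<in>UNIV. \<Sum>m\<in>UNIV.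
            D c i x * D a j x * (K c $ k $ m * K a $ m $ l))"
          by (rule sum3_rotate [symmetric])
        finally show ?thesis
          by (simp add: matrix_matrix_mult_def sum_distrib_left)
      qed
      then show ?thesis by (simp add: vec_eq_iff)
    qed
    have "(\<Sum>a\<in>UNIV. \<partial> i (D a j) x *\<^sub>R K a) = (\<Sum>a\<in>UNIV. \<partial> j (D a i) x *\<^sub>R K a)"
      using second_D_commute [OF x] by simp
    moreover have "(\<Sum>c\<in>UNIV. \<Sum>a\<in>UNIV. (D c j x * D a i x) *\<^sub>R X c a)
      = (\<Sum>c\<in>UNIV. \<Sum>a\<in>UNIV. (D c i x * D a j x) *\<^sub>R X a c)" for X :: "'n \<Rightarrow> 'n \<Rightarrow> real^'n^'n"
      by (subst sum.swap) (simp add: mult.commute)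
    ultimately show ?thesis
      unfolding dB BB curvature_matrix_def P_def [symmetric] K_def [symmetric]
      by (simp add: sum.distrib sum_subtractf scaleR_add_right scaleR_diff_right)
  qed
  finally show ?thesis .
qed

lemma ricci_pullback:
  assumes x: "x \<in> S"
  shows "ricci G j k x = (\<Sum>a\<in>UNIV. \<Sum>b\<in>UNIV. D a j x * D b k x * ricci H a b (\<phi> x))"
proof -
  define Y where "Y c = (\<Sum>a\<in>UNIV. D a j x *\<^sub>R curvature_matrix H c a (\<phi> x)) ** J x" for c
  define K where "K = matrix_inv (J x)"
  have K: "K ** J x = mat 1" "J x ** K = mat 1"
    unfolding K_def using invertible_matrix_inv [OF invertible_J [OF x]] by auto
  have "curvature_matrix G i j x = K ** (\<Sum>c\<in>UNIV. D c i x *\<^sub>R Y c)" for i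
  proof -
    have "K ** (J x ** curvature_matrix G i j x) = K ** (\<Sum>c\<in>UNIV. D c i x *\<^sub>R Y c)"
    proof (rule arg_cong [of _ _ "(**) K"])
      have "D c i x *\<^sub>R Y c = (\<Sum>a\<in>UNIV. (D c i x * D a j x) *\<^sub>R curvature_matrix H c a (\<phi> x)) ** J x" for c
        by (simp add: Y_def scaleR_sum_right scalar_matrix_assoc)
      then show "J x ** curvature_matrix G i j x = (\<Sum>c\<in>UNIV. D c i x *\<^sub>R Y c)"
        by (simp add: curvature_matrix_pullback [OF x] matrix_sum_mult)
    qed
    then show ?thesis by (simp add: matrix_mul_assoc K)
  qed
  then have "ricci G j k x = (\<Sum>i\<in>UNIV. (K ** (\<Sum>c\<in>UNIV. D c i x *\<^sub>R Y c)) $ i $ k)"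
    by (simp add: ricci_def curvature_matrix_nth [symmetric])
  also have "\<dots> = (\<Sum>i\<in>UNIV. \<Sum>d\<in>UNIV. \<Sum>c\<in>UNIV. J x $ c $ i * K $ i $ d * Y c $ d $ k)"
    by (simp add: matrix_matrix_mult_def sum_distrib_left J_nth mult_ac)
  also have "\<dots> = (\<Sum>d\<in>UNIV. \<Sum>c\<in>UNIV. \<Sum>i\<in>UNIV. J x $ c $ i * K $ i $ d * Y c $ d $ k)"
    by (rule sum3_rotate [symmetric])
  also have "\<dots> = (\<Sum>d\<in>UNIV. \<Sum>c\<in>UNIV. (J x ** K) $ c $ d * Y c $ d $ k)"
    by (simp add: matrix_matrix_mult_def sum_distrib_right)
  also have "\<dots> = (\<Sum>d\<in>UNIV. \<Sum>c\<in>UNIV. if d = c then Y c $ c $ k else 0)"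
    by (intro sum.cong) (auto simp: K mat_def)
  also have "\<dots> = (\<Sum>c\<in>UNIV. \<Sum>b\<in>UNIV. \<Sum>a\<in>UNIV. D a j x * D b k x * riemann H c b c a (\<phi> x))"
    by (simp add: Y_def matrix_matrix_mult_def J_nth sum_distrib_left sum_distrib_right
        curvature_matrix_nth mult_ac)
  also have "\<dots> = (\<Sum>b\<in>UNIV. \<Sum>a\<in>UNIV. \<Sum>c\<in>UNIV. D a j x * D b k x * riemann H c b c a (\<phi> x))"
    by (rule sum3_rotate [symmetric])
  also have "\<dots> = (\<Sum>a\<in>UNIV. \<Sum>b\<in>UNIV. D a j x * D b k x * ricci H a b (\<phi> x))"
    by (subst sum.swap) (simp add: ricci_def sum_distrib_left)
  finally show ?thesis .
qed

lemma matrix_inv_pullback: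
  assumes x: "x \<in> S"
  shows "J x ** matrix_inv (G x) ** transpose (J x) = matrix_inv (H (\<phi> x))"
proof -
  have "(transpose (J x) ** H (\<phi> x)) ** (J x ** matrix_inv (G x)) = mat 1"
    using invertible_matrix_inv(1) [OF src.invertible_G [OF x]] pullback_J [OF x]
    by (simp add: matrix_mul_assoc)
  then have "(J x ** matrix_inv (G x)) ** (transpose (J x) ** H (\<phi> x)) = mat 1"
    by (rule matrix_left_right_inverse1)
  then have "(J x ** matrix_inv (G x) ** transpose (J x)) ** H (\<phi> x) = mat 1"
    by (simp add: matrix_mul_assoc)
  then have "(J x ** matrix_inv (G x) ** transpose (J x)) ** (H (\<phi> x) ** matrix_inv (H (\<phi> x)))
      = matrix_inv (H (\<phi> x))"
    by (simp add: matrix_mul_assoc)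
  then show ?thesis
    by (simp add: invertible_matrix_inv(1) tgt.invertible_G \<phi>_mem x)
qed

text \<open>Stated for an arbitrary covariant 2-tensor, as it is applied to the Ricci tensor, to Hessians
  and to products of differentials.\<close>

lemma trace_pullback:
  assumes x: "x \<in> S" and t: "\<And>j k. t j k = (\<Sum>a\<in>UNIV. \<Sum>b\<in>UNIV. D a j x * D b k x * t' a b)"
  shows "(\<Sum>j\<in>UNIV. \<Sum>k\<in>UNIV. matrix_inv (G x) $ j $ k * t j k)
    = (\<Sum>a\<in>UNIV. \<Sum>b\<in>UNIV. matrix_inv (H (\<phi> x)) $ a $ b * t' a b)"
proof -
  have "(\<Sum>j\<in>UNIV. \<Sum>k\<in>UNIV. matrix_inv (G x) $ j $ k * t j k)
    = (\<Sum>j\<in>UNIV. \<Sum>k\<in>UNIV. \<Sum>a\<in>UNIV. \<Sum>b\<in>UNIV. D a j x * matrix_inv (G x) $ j $ k * D b k x * t' a b)"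
    by (simp add: t sum_distrib_left mult_ac)
  also have "\<dots> = (\<Sum>a\<in>UNIV. \<Sum>j\<in>UNIV. \<Sum>k\<in>UNIV. \<Sum>b\<in>UNIV. D a j x * matrix_inv (G x) $ j $ k * D b k x * t' a b)"
    by (rule sum3_rotate)
  also have "\<dots> = (\<Sum>a\<in>UNIV. \<Sum>b\<in>UNIV. \<Sum>j\<in>UNIV. \<Sum>k\<in>UNIV. D a j x * matrix_inv (G x) $ j $ k * D b k x * t' a b)"
    by (rule sum.cong [OF refl sum3_rotate])
  also have "\<dots> = (\<Sum>a\<in>UNIV. \<Sum>b\<in>UNIV. (J x ** matrix_inv (G x) ** transpose (J x)) $ a $ b * t' a b)"
  proof (intro sum.cong refl)
    fix a b
    show "(\<Sum>j\<in>UNIV. \<Sum>k\<in>UNIV. D a j x * matrix_inv (G x) $ j $ k * D b k x * t' a b)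
      = (J x ** matrix_inv (G x) ** transpose (J x)) $ a $ b * t' a b"
      by (subst sum.swap) (simp add: matrix_matrix_mult_def transpose_def J_nth sum_distrib_right)
  qed
  finally show ?thesis
    by (simp add: matrix_inv_pullback [OF x])
qed

text \<open>For the transition maps of an atlas this says that the scalar curvature of a manifold can be
  computed in any chart.\<close>

lemma scalar_coord_pullback:
  "x \<in> S \<Longrightarrow> scalar_coord G x = scalar_coord H (\<phi> x)"
  unfolding scalar_coord_def by (rule trace_pullback [OF _ ricci_pullback])

end

section \<open>Normal coordinates\<close>

text \<open>Gram-Schmidt: the columns of \<open>A\<close> are chosen one after the other, each orthogonal with respect
  to \<open>M\<close> to its predecessors. For an incomplete family such a vector exists by a dimension count.\<close>

lemma ex_orthonormal_frame:
  fixes M :: "real^'n::finite^'n"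
  assumes sym: "transpose M = M" and pos: "\<And>v. v \<noteq> 0 \<Longrightarrow> v \<bullet> (M *v v) > 0"
  obtains A :: "real^'n^'n" where "transpose A ** M ** A = mat 1"
proof -
  have flip: "v \<bullet> (M *v w) = w \<bullet> (M *v v)" for v w
    by (metis dot_lmul_matrix inner_commute sym transpose_matrix_vector)
  have "\<exists>v :: 'n \<Rightarrow> real^'n. \<forall>i\<in>I. \<forall>j\<in>I. v i \<bullet> (M *v v j) = (if i = j then 1 else 0)" for I
  proof (induction I rule: finite_induct [OF finite])
    case 1
    then show ?case by simp
  next
    case (2 k I)
    then obtain v :: "'n \<Rightarrow> real^'n"
      where v: "\<And>i j. i \<in> I \<Longrightarrow> j \<in> I \<Longrightarrow> v i \<bullet> (M *v v j) = (if i = j then 1 else 0)" by blast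
    have "dim ((\<lambda>i. M *v v i) ` I) \<le> card I"
      using dim_le_card' [of "(\<lambda>i. M *v v i) ` I"] card_image_le [of I "\<lambda>i. M *v v i"] by simp
    also have "card I < DIM(real^'n)"
      using 2(2) psubset_card_mono [of "UNIV :: 'n set" I] by auto
    finally obtain w where w: "w \<noteq> 0" "\<And>y. y \<in> span ((\<lambda>i. M *v v i) ` I) \<Longrightarrow> orthogonal w y"
      using orthogonal_to_subspace_exists by blast
    have w0: "w \<bullet> (M *v v i) = 0" if "i \<in> I" for i
      using w(2) [OF span_base] that by (auto simp: orthogonal_def)
    define c where "c = w \<bullet> (M *v w)"
    have "c > 0" using pos [OF w(1)] by (simp add: c_def)
    define u where "u = (1 / sqrt c) *\<^sub>R w"
    have u: "u \<bullet> (M *v u) = 1"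
      using \<open>c > 0\<close> by (simp add: u_def matrix_vector_mult_scaleR flip: c_def)
    have u0: "u \<bullet> (M *v v i) = 0" "v i \<bullet> (M *v u) = 0" if "i \<in> I" for i
      using w0 [OF that] flip [of "v i" u] by (simp_all add: u_def)
    show ?case
      using 2(2) v u u0 by (intro exI [of _ "v(k := u)"]) auto
  qed
  then obtain v :: "'n \<Rightarrow> real^'n" where v: "\<And>i j. v i \<bullet> (M *v v j) = (if i = j then 1 else 0)"
    by (metis UNIV_I)
  define A where "A = (\<chi> a i. v i $ a)"
  have "(transpose A ** (M ** A)) $ i $ j = v i \<bullet> (M *v v j)" for i j
    by (simp add: A_def matrix_matrix_mult_def transpose_def inner_vec_def matrix_vector_mult_def)
  then have "transpose A ** M ** A = mat 1"
    by (simp add: vec_eq_iff mat_def v matrix_mul_assoc [symmetric])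
  then show thesis by (rule that)
qed

lemma (in coord_metric) metric_pullbackI:
  assumes V: "open V" and \<phi>: "\<And>a. smooth_on V (\<lambda>x. \<phi> x $ a)"
    and mem: "\<And>x. x \<in> V \<Longrightarrow> \<phi> x \<in> S"
    and inv: "\<And>x. x \<in> V \<Longrightarrow> invertible (jacobian \<phi> (at x))"
  shows "metric_pullback V
    (\<lambda>x. transpose (jacobian \<phi> (at x)) ** G (\<phi> x) ** jacobian \<phi> (at x)) S G \<phi>"
proof -
  define Jac where "Jac x = jacobian \<phi> (at x)" for x
  have Jac_nth: "Jac x $ a $ i = \<partial> i (\<lambda>y. \<phi> y $ a) x" if "x \<in> V" for x a i
    unfolding Jac_def using smooth_on_differentiable [OF \<phi> that] by (rule jacobian_nth)
  have "coord_metric V (\<lambda>x. transpose (Jac x) ** G (\<phi> x) ** Jac x)"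
  proof
    show "smooth_on V (\<lambda>x. (transpose (Jac x) ** G (\<phi> x) ** Jac x) $ i $ j)" for i j
    proof (rule smooth_on_cong [OF V])
      show "smooth_on V (\<lambda>x. \<Sum>b\<in>UNIV. (\<Sum>a\<in>UNIV. \<partial> i (\<lambda>y. \<phi> y $ a) x * G (\<phi> x) $ a $ b) *
          \<partial> j (\<lambda>y. \<phi> y $ b) x)"
        by (intro smooth_on_sum smooth_on_mult smooth_on_partial_deriv V \<phi> finite
            smooth_on_compose [OF V smooth_G] mem)
    qed (simp add: matrix_matrix_mult_def transpose_def Jac_nth)
  next
    fix x assume x: "x \<in> V"
    show "transpose (transpose (Jac x) ** G (\<phi> x) ** Jac x) = transpose (Jac x) ** G (\<phi> x) ** Jac x"
      by (simp add: matrix_transpose_mul sym_G mem x matrix_mul_assoc)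
    fix v :: "real^'n" assume "v \<noteq> 0"
    then have "Jac x *v v \<noteq> 0"
      using inv [OF x] unfolding Jac_def invertible_left_inverse matrix_left_invertible_ker by blast
    then have "(Jac x *v v) \<bullet> (G (\<phi> x) *v (Jac x *v v)) > 0"
      by (rule pos_G [OF mem [OF x]])
    moreover have "v \<bullet> (transpose (Jac x) *v w) = (Jac x *v v) \<bullet> w" for w
      by (metis dot_lmul_matrix inner_commute transpose_matrix_vector)
    ultimately show "v \<bullet> ((transpose (Jac x) ** G (\<phi> x) ** Jac x) *v v) > 0"
      by (simp only: matrix_vector_mul_assoc [symmetric])
  qed (rule V)
  then show ?thesis
    unfolding metric_pullback_def metric_pullback_axioms_def Jac_def
    by (simp add: coord_metric_axioms \<phi> mem)
qed

text \<open>The frame makes the metric standard at the origin, and the quadratic part of \<open>\<phi>\<close> is chosen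
  such that \<open>\<partial>\<^sub>i \<partial>\<^sub>j \<phi>\<close> cancels the inhomogeneous term in the transformation law of the
  Christoffel symbols.\<close>

lemma (in coord_metric) ex_normal_coordinates:
  assumes p: "p \<in> S"
  obtains V K \<phi> where "metric_pullback V K S G \<phi>" "0 \<in> V" "\<phi> 0 = p" "K 0 = mat 1"
    "\<And>k i j. christoffel K k i j 0 = 0"
proof -
  obtain A :: "real^'n^'n" where A: "transpose A ** G p ** A = mat 1"
    using ex_orthonormal_frame [OF sym_G [OF p] pos_G [OF p]] by blast
  define Q where "Q k i j = (\<Sum>a\<in>UNIV. \<Sum>b\<in>UNIV. A $ a $ i * A $ b $ j * christoffel G k a b p)" for k i j
  have Q_commute: "Q k i j = Q k j i" for k i j
    unfolding Q_def using christoffel_commute [OF p] by (subst sum.swap) (simp add: mult_ac)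
  define \<phi> :: "real^'n \<Rightarrow> real^'n" where
    "\<phi> x = (\<chi> k. p $ k + ((\<Sum>a\<in>UNIV. A $ k $ a * x $ a)
      - (\<Sum>a\<in>UNIV. \<Sum>b\<in>UNIV. Q k a b * (x $ a * x $ b)) / 2))" for x
  have smooth: "smooth_on UNIV (\<lambda>x. \<phi> x $ k)" for k
    unfolding \<phi>_def vec_lambda_beta
    by (intro smooth_on_add smooth_on_diff smooth_on_divide_numeral smooth_on_sum smooth_on_mult
        smooth_on_const smooth_on_nth open_UNIV finite)
  have d: "(\<lambda>x. x $ k) differentiable (at x)" for k and x :: "real^'n"
    by (intro bounded_linear_imp_differentiable bounded_linear_vec_nth)
  have D: "\<partial> i (\<lambda>x. \<phi> x $ k) = (\<lambda>x. A $ k $ i - (\<Sum>b\<in>UNIV. Q k i b * x $ b))" for i k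
  proof
    fix x :: "real^'n"
    have "\<partial> i (\<lambda>x. \<phi> x $ k) x = (\<Sum>a\<in>UNIV. A $ k $ a * \<partial> i (\<lambda>x. x $ a) x)
      - (\<Sum>a\<in>UNIV. \<Sum>b\<in>UNIV. Q k a b * (\<partial> i (\<lambda>x. x $ a) x * x $ b + x $ a * \<partial> i (\<lambda>x. x $ b) x)) / 2"
      using partial_deriv_cmult [of "\<lambda>x. \<Sum>a\<in>UNIV. \<Sum>b\<in>UNIV. Q k a b * (x $ a * x $ b)" x i "1/2"]
      by (simp add: \<phi>_def partial_deriv_add partial_deriv_diff partial_deriv_sum partial_deriv_cmult
          partial_deriv_mult d)
    also have "\<dots> = A $ k $ i - (\<Sum>b\<in>UNIV. Q k i b * x $ b)"
    proof -
      have "Q k a b * (\<partial> i (\<lambda>x. x $ a) x * x $ b + x $ a * \<partial> i (\<lambda>x. x $ b) x)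
        = (if i = a then Q k a b * x $ b else 0) + (if i = b then Q k a b * x $ a else 0)" for a b
        by (simp add: partial_deriv_nth ring_distribs)
      moreover have "(\<Sum>a\<in>UNIV. \<Sum>b\<in>UNIV. if i = a then Q k a b * x $ b else 0) = (\<Sum>b\<in>UNIV. Q k i b * x $ b)"
        by (subst sum.swap) simp
      moreover have "(\<Sum>a\<in>UNIV. \<Sum>b\<in>UNIV. if i = b then Q k a b * x $ a else 0) = (\<Sum>b\<in>UNIV. Q k i b * x $ b)"
        by (simp add: Q_commute [of k i])
      ultimately show ?thesis
        by (simp add: partial_deriv_nth sum.distrib if_distrib [of "(*) _"] cong: if_cong)
    qed
    finally show "\<partial> i (\<lambda>x. \<phi> x $ k) x = A $ k $ i - (\<Sum>b\<in>UNIV. Q k i b * x $ b)" .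
  qed
  have DD: "\<partial> j (\<partial> i (\<lambda>x. \<phi> x $ k)) x = - Q k i j" for i j k x
    unfolding D
    by (simp add: partial_deriv_diff partial_deriv_sum partial_deriv_cmult d partial_deriv_nth
        if_distrib [of "(*) _"] cong: if_cong)
  have [simp]: "\<phi> 0 = p"
    by (simp add: \<phi>_def vec_eq_iff)
  have jac: "jacobian \<phi> (at x) $ k $ i = \<partial> i (\<lambda>x. \<phi> x $ k) x" for x k i
    by (rule jacobian_nth) (rule smooth_on_differentiable [OF smooth UNIV_I])
  have jac0: "jacobian \<phi> (at 0) = A"
    by (simp add: vec_eq_iff jac D)
  \<comment> \<open>\<open>\<phi>\<close> is used where it maps into \<open>S\<close> and its Jacobian is invertible.\<close>
  define V where "V = \<phi> -` S \<inter> (\<lambda>x. det (jacobian \<phi> (at x))) -` (- {0})"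
  have "continuous_on UNIV \<phi>"
    using has_derivative_vec_partial_deriv [OF smooth_on_differentiable [OF smooth UNIV_I]]
    by (meson continuous_at_imp_continuous_on has_derivative_continuous)
  moreover have "smooth_on UNIV (\<lambda>x. det (jacobian \<phi> (at x)))"
    using smooth_on_partial_deriv [OF smooth] by (intro smooth_on_det) (simp_all add: jac)
  ultimately have "open V"
    unfolding V_def by (intro open_Int open_vimage open_S smooth_on_continuous_on) auto
  then have pb: "metric_pullback V
      (\<lambda>x. transpose (jacobian \<phi> (at x)) ** G (\<phi> x) ** jacobian \<phi> (at x)) S G \<phi>" (is "metric_pullback V ?K S G \<phi>")
    by (intro metric_pullbackI smooth_on_subset [OF smooth]) (auto simp: V_def invertible_det_nz)
  have "det A \<noteq> 0"
    using arg_cong [OF A, of det] by (auto simp: det_mul)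
  then have "0 \<in> V" by (simp add: V_def p jac0)
  interpret metric_pullback V ?K S G \<phi> by (rule pb)
  have "christoffel ?K k i j 0 = 0" for k i j
  proof -
    have "(\<Sum>k\<in>UNIV. \<partial> k (\<lambda>y. \<phi> y $ d) 0 * christoffel ?K k i j 0) = 0" for d
      unfolding christoffel_pullback [OF \<open>0 \<in> V\<close>] by (simp add: DD Q_commute [of d j i]) (simp add: D Q_def)
    then have "J 0 *v (\<chi> k. christoffel ?K k i j 0) = 0"
      by (simp add: vec_eq_iff matrix_vector_mult_def J_def)
    then have "(\<chi> k. christoffel ?K k i j 0) = 0"
      using invertible_J [OF \<open>0 \<in> V\<close>, unfolded invertible_left_inverse matrix_left_invertible_ker] by blast
    then show ?thesis by (simp add: vec_eq_iff)
  qed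
  moreover have "?K 0 = mat 1" by (simp add: jac0 A)
  ultimately show thesis
    using that [OF pb \<open>0 \<in> V\<close> \<open>\<phi> 0 = p\<close>] by blast
qed

section \<open>The scalar curvature equation of a gradient Yamabe soliton\<close>

locale normal_coordinates = coord_metric S G
  for S :: "(real^'n::finite) set" and G +
  fixes z :: "real^'n"
  assumes z: "z \<in> S" and G_z: "G z = mat 1" and christoffel_z: "christoffel G k i j z = 0"
begin

lemma G_z_nth: "G z $ i $ j = (if i = j then 1 else 0)"
  by (simp add: G_z mat_def)

lemma sum_G_z: "(\<Sum>k\<in>UNIV. G z $ l $ k * t k) = t l"
proof -
  have "(\<Sum>k\<in>UNIV. G z $ l $ k * t k) = (\<Sum>k\<in>UNIV. if l = k then t k else 0)"
    by (intro sum.cong) (auto simp: G_z_nth)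
  then show ?thesis by simp
qed

lemma G_inv_z: "matrix_inv (G z) = mat 1"
  using invertible_matrix_inv(1) [OF invertible_G [OF z]] by (simp add: G_z)

lemma trace_z: "(\<Sum>j\<in>UNIV. \<Sum>k\<in>UNIV. matrix_inv (G z) $ j $ k * t j k) = (\<Sum>j\<in>UNIV. t j j)"
proof -
  have "(\<Sum>k\<in>UNIV. matrix_inv (G z) $ j $ k * t j k) = t j j" for j
    unfolding G_inv_z using sum_G_z [of j "t j"] by (simp add: G_z)
  then show ?thesis by simp
qed

lemma partial_G_z: "\<partial> k (\<lambda>y. G y $ i $ j) z = 0"
  by (simp add: metric_compatible [OF z] christoffel_z)

lemma partial_G_inv_z: "\<partial> k (\<lambda>y. matrix_inv (G y) $ i $ j) z = 0"
proof -
  have "\<partial> k (\<lambda>y. \<Sum>m\<in>UNIV. G y $ i $ m * matrix_inv (G y) $ m $ j) z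
      = \<partial> k (\<lambda>y. if i = j then 1 else 0) z"
    by (rule partial_deriv_cong [OF open_S z]) (rule G_inv_sum)
  then have "(\<Sum>m\<in>UNIV. G z $ i $ m * \<partial> k (\<lambda>y. matrix_inv (G y) $ m $ j) z) = 0"
    using smooth_on_differentiable [OF smooth_G z] smooth_on_differentiable [OF smooth_G_inv z]
    by (simp add: partial_deriv_sum partial_deriv_mult partial_G_z)
  then show ?thesis by (simp add: sum_G_z)
qed

lemma second_partial_G_commute: "\<partial> l (\<partial> i (\<lambda>y. G y $ j $ k)) x = \<partial> l (\<partial> i (\<lambda>y. G y $ k $ j)) x"
  if "x \<in> S"
  using that by (rule second_partial_cong [OF open_S]) (rule G_commute)

lemma partial_christoffel_z:
  "\<partial> m (christoffel G l i j) z = (\<partial> m (\<partial> i (\<lambda>y. G y $ j $ l)) z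
    + \<partial> m (\<partial> j (\<lambda>y. G y $ i $ l)) z - \<partial> m (\<partial> l (\<lambda>y. G y $ i $ j)) z) / 2"
proof -
  have "\<partial> m (\<lambda>y. \<Sum>k\<in>UNIV. G y $ l $ k * christoffel G k i j y) z = \<partial> m (\<lambda>y. 1 / 2 *
    (\<partial> i (\<lambda>y. G y $ j $ l) y + \<partial> j (\<lambda>y. G y $ i $ l) y - \<partial> l (\<lambda>y. G y $ i $ j) y)) z"
    by (rule partial_deriv_cong [OF open_S z]) (simp add: christoffel_lowered)
  moreover have "\<partial> m (\<lambda>y. \<Sum>k\<in>UNIV. G y $ l $ k * christoffel G k i j y) z = \<partial> m (christoffel G l i j) z"
    using smooth_on_differentiable [OF smooth_G z] smooth_on_differentiable [OF smooth_christoffel z]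
    by (simp add: partial_deriv_sum partial_deriv_mult partial_G_z sum_G_z)
  ultimately show ?thesis
    using smooth_on_differentiable [OF smooth_partial_G z]
    by (simp add: partial_deriv_divide partial_deriv_diff partial_deriv_add)
qed

lemma second_partial_christoffel_z:
  "\<partial> n (\<partial> m (christoffel G l i j)) z = (\<partial> n (\<partial> m (\<partial> i (\<lambda>y. G y $ j $ l))) z
    + \<partial> n (\<partial> m (\<partial> j (\<lambda>y. G y $ i $ l))) z - \<partial> n (\<partial> m (\<partial> l (\<lambda>y. G y $ i $ j))) z) / 2"
proof -
  have "\<partial> n (\<partial> m (\<lambda>y. \<Sum>k\<in>UNIV. G y $ l $ k * christoffel G k i j y)) z = \<partial> n (\<partial> m (\<lambda>y. 1 / 2 *
    (\<partial> i (\<lambda>y. G y $ j $ l) y + \<partial> j (\<lambda>y. G y $ i $ l) y - \<partial> l (\<lambda>y. G y $ i $ j) y))) z"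
    by (rule second_partial_cong [OF open_S z]) (simp add: christoffel_lowered)
  also have "\<dots> = 1 / 2 * (\<partial> n (\<partial> m (\<partial> i (\<lambda>y. G y $ j $ l))) z
    + \<partial> n (\<partial> m (\<partial> j (\<lambda>y. G y $ i $ l))) z - \<partial> n (\<partial> m (\<partial> l (\<lambda>y. G y $ i $ j))) z)"
    using smooth_partial_G
    by (subst second_partial_mult [OF open_S z];
        simp add: second_partial_diff [OF open_S z] second_partial_add [OF open_S z]
          smooth_on_const smooth_on_add smooth_on_diff open_S partial_deriv_const [abs_def])
  finally show ?thesis
    by (simp add: second_partial_sum [OF open_S z smooth_on_mult [OF open_S smooth_G smooth_christoffel]]
        second_partial_mult [OF open_S z smooth_G smooth_christoffel] partial_G_z christoffel_z sum_G_z)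
qed

lemma riemann_z: "riemann G l k i j z = \<partial> i (christoffel G l j k) z - \<partial> j (christoffel G l i k) z"
  by (simp add: riemann_def christoffel_z)

text \<open>The quadratic terms of the curvature vanish to second order at \<open>z\<close>.\<close>

lemma partial_riemann_z:
  "\<partial> m (riemann G l k i j) z = \<partial> m (\<partial> i (christoffel G l j k)) z - \<partial> m (\<partial> j (christoffel G l i k)) z"
proof -
  note d = smooth_on_differentiable [OF smooth_christoffel z]
    smooth_on_differentiable [OF smooth_on_partial_deriv [OF smooth_christoffel] z]
  show ?thesis
    unfolding riemann_def [abs_def]
    by (simp add: d partial_deriv_add partial_deriv_diff partial_deriv_sum partial_deriv_mult christoffel_z)
qed

lemma scalar_coord_z: "scalar_coord G z = (\<Sum>j\<in>UNIV. \<Sum>i\<in>UNIV. riemann G i j i j z)"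
  by (simp add: scalar_coord_def trace_z ricci_def)

lemma partial_scalar_coord_z:
  "\<partial> m (scalar_coord G) z = (\<Sum>j\<in>UNIV. \<Sum>i\<in>UNIV. \<partial> m (riemann G i j i j) z)"
proof -
  note d = smooth_on_differentiable [OF smooth_G_inv z] smooth_on_differentiable [OF smooth_ricci z]
  have "\<partial> m (scalar_coord G) z = (\<Sum>j\<in>UNIV. \<Sum>k\<in>UNIV. matrix_inv (G z) $ j $ k * \<partial> m (ricci G j k) z)"
    unfolding scalar_coord_def [abs_def]
    by (simp add: d partial_deriv_sum partial_deriv_mult partial_G_inv_z)
  also have "\<dots> = (\<Sum>j\<in>UNIV. \<partial> m (ricci G j j) z)"
    by (rule trace_z)
  finally show ?thesis
    unfolding ricci_def [abs_def]
    by (simp add: partial_deriv_sum smooth_on_differentiable [OF smooth_riemann z])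
qed

text \<open>The contracted second Bianchi identity. At the centre of normal coordinates the derivative of
  the curvature is an alternating sum of third derivatives of the metric, so that both sides can be
  compared term by term.\<close>

lemma contracted_bianchi_z:
  "(\<Sum>i\<in>UNIV. \<Sum>j\<in>UNIV. \<partial> j (riemann G m i i j) z) = - \<partial> m (scalar_coord G) z / 2"
proof -
  \<comment> \<open>\<open>T\<close> is symmetric in its first three and in its last two indices. The two sums \<open>X\<close> and \<open>Y\<close> are the
    full contractions that remain.\<close>
  define T where "T a b c i j = \<partial> a (\<partial> b (\<partial> c (\<lambda>y. G y $ i $ j))) z" for a b c i j
  have T1: "T a b c i j = T b a c i j" for a b c i j
    unfolding T_def by (rule partial_deriv_commute [OF open_S smooth_partial_G z])
  have T2: "T a b c i j = T a c b i j" for a b c i j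
    unfolding T_def by (intro partial_deriv_cong [OF open_S z] partial_deriv_commute [OF open_S smooth_G])
  have T3: "T a b c i j = T a b c j i" for a b c i j
    unfolding T_def by (intro partial_deriv_cong [OF open_S z] second_partial_G_commute)
  have R: "\<partial> l (riemann G m k i j) z = (T l i k j m - T l i m j k - T l j k i m + T l j m i k) / 2" for l m k i j
    using T2 [of l i j k m] by (simp add: partial_riemann_z second_partial_christoffel_z T_def [symmetric] field_simps)
  define X where "X = (\<Sum>i\<in>UNIV. \<Sum>j\<in>UNIV. T m i j i j)"
  define Y where "Y = (\<Sum>i\<in>UNIV. \<Sum>j\<in>UNIV. T m j j i i)"
  have Y_swap: "(\<Sum>i\<in>UNIV. \<Sum>j\<in>UNIV. T m i i j j) = Y"
    unfolding Y_def by (rule sum.swap)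
  have "\<partial> m (scalar_coord G) z = (\<Sum>j\<in>UNIV. \<Sum>i\<in>UNIV. (T m i j i j - T m i i j j - T m j j i i + T m i j i j) / 2)"
    unfolding partial_scalar_coord_z R
    by (intro sum.cong refl) (metis T2 T3)
  also have "\<dots> = ((\<Sum>j\<in>UNIV. \<Sum>i\<in>UNIV. T m i j i j) - (\<Sum>j\<in>UNIV. \<Sum>i\<in>UNIV. T m i i j j)
      - (\<Sum>j\<in>UNIV. \<Sum>i\<in>UNIV. T m j j i i) + (\<Sum>j\<in>UNIV. \<Sum>i\<in>UNIV. T m i j i j)) / 2"
    by (simp add: sum.distrib sum_subtractf sum_divide_distrib add_divide_distrib diff_divide_distrib sum_negf)
  also have "(\<Sum>j\<in>UNIV. \<Sum>i\<in>UNIV. T m i j i j) = X"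
    unfolding X_def by (rule sum.swap)
  also have "(\<Sum>j\<in>UNIV. \<Sum>i\<in>UNIV. T m i i j j) = Y"
    by (simp add: Y_def)
  also have "(\<Sum>j\<in>UNIV. \<Sum>i\<in>UNIV. T m j j i i) = Y"
    by (rule Y_swap)
  finally have 1: "\<partial> m (scalar_coord G) z = X - Y" by simp
  have "(\<Sum>i\<in>UNIV. \<Sum>j\<in>UNIV. \<partial> j (riemann G m i i j) z)
      = (\<Sum>i\<in>UNIV. \<Sum>j\<in>UNIV. (T i i j j m - T m i j i j - T j j i i m + T m j j i i) / 2)"
    unfolding R by (intro sum.cong refl) (metis T1 T2 T3)
  also have "\<dots> = ((\<Sum>i\<in>UNIV. \<Sum>j\<in>UNIV. T i i j j m) - X - (\<Sum>i\<in>UNIV. \<Sum>j\<in>UNIV. T j j i i m) + Y) / 2"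
    by (simp add: X_def Y_def sum.distrib sum_subtractf sum_divide_distrib add_divide_distrib diff_divide_distrib)
  also have "(\<Sum>i\<in>UNIV. \<Sum>j\<in>UNIV. T i i j j m) = (\<Sum>i\<in>UNIV. \<Sum>j\<in>UNIV. T j j i i m)"
    by (rule sum.swap)
  finally show ?thesis by (simp add: 1)
qed

text \<open>Two derivatives of \<open>\<nabla>\<^sup>2 F = h g\<close>, taken at \<open>z\<close>. Antisymmetrizing in \<open>i\<close> and \<open>j\<close> removes the fourth
  derivatives of \<open>F\<close> and turns the derivatives of the Christoffel symbols into curvature.\<close>

lemma differentiated_ricci_identity_z:
  assumes F: "smooth_on S F" and h: "smooth_on S h"
    and eq: "\<And>y i j. y \<in> S \<Longrightarrow> hessian G F i j y = h y * G y $ i $ j"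
  shows "- (\<Sum>m\<in>UNIV. \<partial> m F z * \<partial> l (riemann G m k i j) z) - h z * riemann G l k i j z
    = \<partial> l (\<partial> i h) z * G z $ j $ k - \<partial> l (\<partial> j h) z * G z $ i $ k"
proof -
  note smooth = smooth_on_partial_deriv [OF F] smooth_on_partial_deriv [OF smooth_on_partial_deriv [OF F]]
    smooth_christoffel
  have hess_z: "\<partial> i (\<partial> j F) z = h z * G z $ i $ j" for i j
    using eq [OF z, of i j] by (simp add: hessian_def christoffel_z)
  have dd: "\<partial> l (\<partial> i (\<partial> j (\<partial> k F))) z - (\<Sum>m\<in>UNIV. \<partial> l (\<partial> i (christoffel G m j k)) z * \<partial> m F z)
      - h z * (\<partial> i (christoffel G l j k) z + \<partial> l (christoffel G i j k) z)
    = \<partial> l (\<partial> i h) z * G z $ j $ k + h z * \<partial> l (\<partial> i (\<lambda>y. G y $ j $ k)) z" for l i j k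
  proof -
    have sm: "smooth_on S (\<lambda>y. christoffel G m j k y * \<partial> m F y)" for m
      by (intro smooth_on_mult open_S smooth)
    have "\<partial> l (\<partial> i (\<lambda>y. \<partial> j (\<partial> k F) y - (\<Sum>m\<in>UNIV. christoffel G m j k y * \<partial> m F y))) z
      = \<partial> l (\<partial> i (\<lambda>y. h y * G y $ j $ k)) z"
      using eq by (intro second_partial_cong [OF open_S z]) (simp add: hessian_def)
    moreover have "(\<Sum>m\<in>UNIV. \<partial> i (christoffel G m j k) z * \<partial> l (\<partial> m F) z) = h z * \<partial> i (christoffel G l j k) z" for i l
      using sum_G_z [of l "\<lambda>m. \<partial> i (christoffel G m j k) z"] by (simp add: hess_z sum_distrib_left [symmetric] mult_ac)
    ultimately show ?thesis
      by (simp add: second_partial_diff [OF open_S z _ smooth_on_sum [OF open_S finite sm]] smooth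
          second_partial_sum [OF open_S z sm] second_partial_mult [OF open_S z]
          h smooth_G christoffel_z partial_G_z sum.distrib ring_distribs)
  qed
  have F4: "\<partial> l (\<partial> i (\<partial> j (\<partial> k F))) z = \<partial> l (\<partial> j (\<partial> i (\<partial> k F))) z"
    by (intro partial_deriv_cong [OF open_S z] partial_deriv_commute [OF open_S smooth(1)])
  \<comment> \<open>This cancels the Christoffel terms that the product rule leaves besides the curvature.\<close>
  have compat: "\<partial> l (\<partial> i (\<lambda>y. G y $ j $ k)) z - \<partial> l (\<partial> j (\<lambda>y. G y $ i $ k)) z
      = \<partial> l (christoffel G j i k) z - \<partial> l (christoffel G i j k) z"
    using second_partial_G_commute [OF z, of l i k j] second_partial_G_commute [OF z, of l j k i]
      second_partial_G_commute [OF z, of l k i j]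
    by (simp add: partial_christoffel_z field_simps)
  have "(\<Sum>m\<in>UNIV. \<partial> m F z * \<partial> l (riemann G m k i j) z)
    = (\<Sum>m\<in>UNIV. \<partial> l (\<partial> i (christoffel G m j k)) z * \<partial> m F z) - (\<Sum>m\<in>UNIV. \<partial> l (\<partial> j (christoffel G m i k)) z * \<partial> m F z)"
    by (simp add: partial_riemann_z ring_distribs sum_subtractf mult.commute)
  moreover have "h z * (\<partial> l (\<partial> i (\<lambda>y. G y $ j $ k)) z - \<partial> l (\<partial> j (\<lambda>y. G y $ i $ k)) z)
    = h z * (\<partial> l (christoffel G j i k) z - \<partial> l (christoffel G i j k) z)"
    by (simp add: compat)
  ultimately show ?thesis
    using dd [of l i j k] dd [of l j i k] F4 by (simp add: riemann_z ring_distribs)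
qed

lemma soliton_equation_z:
  assumes F: "smooth_on S F"
    and eq: "\<And>y i j. y \<in> S \<Longrightarrow> hessian G F i j y = (scalar_coord G y - \<rho>) * G y $ i $ j"
  shows "(real CARD('n) - 1) * (\<Sum>j\<in>UNIV. \<partial> j (\<partial> j (scalar_coord G)) z)
    + (\<Sum>j\<in>UNIV. \<partial> j (scalar_coord G) z * \<partial> j F z) / 2
    + scalar_coord G z * (scalar_coord G z - \<rho>) = 0"
proof -
  define h where "h y = scalar_coord G y - \<rho>" for y
  have smooth_h: "smooth_on S h"
    unfolding h_def by (intro smooth_on_diff smooth_scalar_coord smooth_on_const open_S)
  have dh: "\<partial> j h y = \<partial> j (scalar_coord G) y" if "y \<in> S" for j y
    unfolding h_def
    using partial_deriv_diff [OF smooth_on_differentiable [OF smooth_scalar_coord that], of "\<lambda>_. \<rho>" j] by simp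
  have ddh: "\<partial> i (\<partial> j h) z = \<partial> i (\<partial> j (scalar_coord G)) z" for i j
    by (rule partial_deriv_cong [OF open_S z dh])
  define L where "L = (\<Sum>j\<in>UNIV. \<partial> j (\<partial> j (scalar_coord G)) z)"
  have "- (\<Sum>m\<in>UNIV. \<partial> m F z * \<partial> j (riemann G m i i j) z) - h z * riemann G j i i j z
    = \<partial> j (\<partial> i h) z * G z $ j $ i - \<partial> j (\<partial> j h) z * G z $ i $ i" for i j
    by (rule differentiated_ricci_identity_z [OF F smooth_h]) (simp add: eq h_def)
  then have "- (\<Sum>i\<in>UNIV. \<Sum>j\<in>UNIV. \<Sum>m\<in>UNIV. \<partial> m F z * \<partial> j (riemann G m i i j) z)
      - h z * (\<Sum>i\<in>UNIV. \<Sum>j\<in>UNIV. riemann G j i i j z)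
    = (\<Sum>i\<in>UNIV. \<Sum>j\<in>UNIV. \<partial> j (\<partial> i h) z * G z $ j $ i - \<partial> j (\<partial> j h) z * G z $ i $ i)"
    by (simp add: sum_distrib_left sum_subtractf [symmetric] sum_negf [symmetric])
  also have "\<dots> = (1 - real CARD('n)) * L"
  proof -
    have "(\<Sum>j\<in>UNIV. \<partial> j (\<partial> i h) z * G z $ j $ i) = \<partial> i (\<partial> i h) z" for i
      using sum_G_z [of i "\<lambda>j. \<partial> j (\<partial> i h) z"] by (simp add: G_commute [OF z, of _ i] mult.commute)
    then show ?thesis
      by (simp add: L_def sum_subtractf G_z_nth ddh left_diff_distrib)
  qed
  also have "(\<Sum>i\<in>UNIV. \<Sum>j\<in>UNIV. riemann G j i i j z) = - scalar_coord G z"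
    by (simp add: scalar_coord_z riemann_z sum_negf [symmetric])
  also have "(\<Sum>i\<in>UNIV. \<Sum>j\<in>UNIV. \<Sum>m\<in>UNIV. \<partial> m F z * \<partial> j (riemann G m i i j) z)
    = (\<Sum>m\<in>UNIV. \<partial> m F z * (\<Sum>i\<in>UNIV. \<Sum>j\<in>UNIV. \<partial> j (riemann G m i i j) z))"
    by (subst sum3_rotate) (simp add: sum_distrib_left)
  also have "\<dots> = - (\<Sum>m\<in>UNIV. \<partial> m (scalar_coord G) z * \<partial> m F z) / 2"
    by (simp add: contracted_bianchi_z sum_negf sum_divide_distrib [symmetric] mult.commute)
  finally show ?thesis
    by (simp add: L_def h_def algebra_simps)
qed

end

text \<open>The equation \<open>(n - 1) \<Delta>R + \<langle>\<nabla>R, \<nabla>F\<rangle> / 2 + R (R - \<rho>) = 0\<close>. Each of its terms is invariant under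
  isometries, so it suffices to check it at the centre of normal coordinates.\<close>

theorem (in coord_metric) soliton_scalar_equation:
  assumes F: "smooth_on S F"
    and eq: "\<And>y i j. y \<in> S \<Longrightarrow> hessian G F i j y = (scalar_coord G y - \<rho>) * G y $ i $ j"
    and p: "p \<in> S"
  shows "(real CARD('n) - 1) *
      (\<Sum>a\<in>UNIV. \<Sum>b\<in>UNIV. matrix_inv (G p) $ a $ b * hessian G (scalar_coord G) a b p)
    + (\<Sum>a\<in>UNIV. \<Sum>b\<in>UNIV. matrix_inv (G p) $ a $ b * (\<partial> a (scalar_coord G) p * \<partial> b F p)) / 2
    + scalar_coord G p * (scalar_coord G p - \<rho>) = 0"
proof -
  obtain V K \<phi> where pb: "metric_pullback V K S G \<phi>" and V: "0 \<in> V" and \<phi>0: "\<phi> 0 = p"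
    and K0: "K 0 = mat 1" and \<Gamma>0: "\<And>k i j. christoffel K k i j 0 = 0"
    using ex_normal_coordinates [OF p] by blast
  interpret metric_pullback V K S G \<phi> by (rule pb)
  interpret normal_coordinates V K 0
    by unfold_locales (simp_all add: V K0 \<Gamma>0)
  have R: "scalar_coord K x = scalar_coord G (\<phi> x)" if "x \<in> V" for x
    using that by (rule scalar_coord_pullback)
  have dR: "\<partial> j (scalar_coord K) x = \<partial> j (\<lambda>y. scalar_coord G (\<phi> y)) x" if "x \<in> V" for j x
    using that by (rule partial_deriv_cong [OF src.open_S]) (rule R)
  have ddR: "\<partial> i (\<partial> j (scalar_coord K)) 0 = hessian K (\<lambda>y. scalar_coord G (\<phi> y)) i j 0" for i j
    using partial_deriv_cong [OF src.open_S V dR] by (simp add: hessian_def christoffel_z)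
  have eqK: "hessian K (\<lambda>y. F (\<phi> y)) i j x = (scalar_coord K x - \<rho>) * K x $ i $ j" if "x \<in> V" for x i j
    using that by (simp add: hessian_pullback F eq \<phi>_mem R pullback_nth sum_distrib_left mult_ac)
  have "(real CARD('n) - 1) * (\<Sum>j\<in>UNIV. hessian K (\<lambda>y. scalar_coord G (\<phi> y)) j j 0)
    + (\<Sum>j\<in>UNIV. \<partial> j (\<lambda>y. scalar_coord G (\<phi> y)) 0 * \<partial> j (\<lambda>y. F (\<phi> y)) 0) / 2
    + scalar_coord G p * (scalar_coord G p - \<rho>) = 0"
    using soliton_equation_z [OF smooth_compose [OF F] eqK]
    by (simp add: ddR dR R V \<phi>0)
  moreover have "(\<Sum>j\<in>UNIV. hessian K (\<lambda>y. scalar_coord G (\<phi> y)) j j 0)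
    = (\<Sum>a\<in>UNIV. \<Sum>b\<in>UNIV. matrix_inv (G p) $ a $ b * hessian G (scalar_coord G) a b p)"
    unfolding trace_z [of "\<lambda>j k. hessian K (\<lambda>y. scalar_coord G (\<phi> y)) j k 0", symmetric] \<phi>0 [symmetric]
    by (rule trace_pullback [OF V hessian_pullback [OF V smooth_scalar_coord]])
  moreover have "(\<Sum>j\<in>UNIV. \<partial> j (\<lambda>y. scalar_coord G (\<phi> y)) 0 * \<partial> j (\<lambda>y. F (\<phi> y)) 0)
    = (\<Sum>a\<in>UNIV. \<Sum>b\<in>UNIV. matrix_inv (G p) $ a $ b * (\<partial> a (scalar_coord G) p * \<partial> b F p))"
    unfolding trace_z [of "\<lambda>j k. \<partial> j (\<lambda>y. scalar_coord G (\<phi> y)) 0 * \<partial> k (\<lambda>y. F (\<phi> y)) 0", symmetric] \<phi>0 [symmetric]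
    by (rule trace_pullback [OF V])
      (simp only: partial_compose [OF V F] partial_compose [OF V smooth_scalar_coord] sum_product,
        simp add: mult_ac)
  ultimately show ?thesis by simp
qed

section \<open>The strong maximum principle\<close>

lemma partial_deriv_local_min:
  fixes u :: "real^'n::finite \<Rightarrow> real"
  assumes u: "u differentiable (at y)" and r: "r > 0" and min: "\<And>x. x \<in> ball y r \<Longrightarrow> u y \<le> u x"
  shows "\<partial> i u y = 0"
proof -
  have "((\<lambda>t. u (y + t *\<^sub>R axis i 1)) has_real_derivative \<partial> i u (y + 0 *\<^sub>R axis i 1)) (at 0)"
    by (rule has_real_derivative_axis) (simp add: u)
  moreover have "u (y + 0 *\<^sub>R axis i 1) \<le> u (y + t *\<^sub>R axis i 1)" if "\<bar>0 - t\<bar> < r" for t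
    using min [of "y + t *\<^sub>R axis i 1"] that by (simp add: dist_norm)
  ultimately show ?thesis
    using DERIV_local_min [OF _ r] by fastforce
qed

text \<open>If the second derivative along \<open>v\<close> were negative, the first derivative, which vanishes at \<open>y\<close>,
  would be negative shortly after \<open>y\<close>, and the function would decrease.\<close>

lemma second_partial_deriv_local_min:
  fixes u :: "real^'n::finite \<Rightarrow> real"
  assumes S: "open S" and u: "smooth_on S u" and y: "y \<in> S"
    and r: "r > 0" and min: "\<And>x. x \<in> ball y r \<Longrightarrow> u y \<le> u x"
  shows "(\<Sum>i\<in>UNIV. \<Sum>j\<in>UNIV. v $ i * v $ j * \<partial> i (\<partial> j u) y) \<ge> 0"
proof (rule ccontr)
  define Q where "Q = (\<Sum>j\<in>UNIV. v $ j * (\<Sum>i\<in>UNIV. v $ i * \<partial> i (\<partial> j u) y))"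
  assume "\<not> ?thesis"
  moreover have "(\<Sum>i\<in>UNIV. \<Sum>j\<in>UNIV. v $ i * v $ j * \<partial> i (\<partial> j u) y) = Q"
    unfolding Q_def by (subst sum.swap) (simp add: sum_distrib_left mult_ac)
  ultimately have "Q < 0" by simp
  define \<psi>' where "\<psi>' t = (\<Sum>j\<in>UNIV. v $ j * \<partial> j u (y + t *\<^sub>R v))" for t
  obtain r' where r': "r' > 0" "ball y r' \<subseteq> S"
    using S y by (auto simp: open_contains_ball)
  have "(\<psi>' has_real_derivative (\<Sum>j\<in>UNIV. v $ j * (\<Sum>i\<in>UNIV. v $ i * \<partial> i (\<partial> j u) (y + 0 *\<^sub>R v)))) (at 0)"
    unfolding \<psi>'_def using y
    by (intro DERIV_sum DERIV_cmult has_real_derivative_line smooth_on_differentiable [of S]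
        smooth_on_partial_deriv u) simp
  then have "(\<psi>' has_real_derivative Q) (at 0)"
    by (simp add: Q_def)
  from has_real_derivative_neg_dec_right [OF this \<open>Q < 0\<close>]
  obtain d where d: "d > 0" "\<And>h. 0 < h \<Longrightarrow> h < d \<Longrightarrow> \<psi>' h < \<psi>' 0" by auto
  have "\<psi>' 0 = 0"
    using partial_deriv_local_min [OF smooth_on_differentiable [OF u y] r min] by (simp add: \<psi>'_def)
  define c where "c = norm v + 1"
  have "c > 0" using norm_ge_zero [of v] by (simp add: c_def add_nonneg_pos)
  define h where "h = min d (min r r' / c) / 2"
  have "h > 0" "h < d" using d r r' \<open>c > 0\<close> by (auto simp: h_def)
  have "h \<le> min r r' / c / 2"
    unfolding h_def by (rule divide_right_mono) simp_all
  then have "h * c \<le> min r r' / 2"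
    using \<open>c > 0\<close> by (simp add: field_simps)
  moreover have "h * norm v < h * c" using \<open>h > 0\<close> by (simp add: c_def)
  ultimately have "h * norm v < min r r'" using r r' by simp
  have near: "y + t *\<^sub>R v \<in> ball y (min r r')" if "0 \<le> t" "t \<le> h" for t
    using that mult_right_mono [of t h "norm v"] \<open>h * norm v < min r r'\<close> by (simp add: dist_norm)
  have "((\<lambda>t. u (y + t *\<^sub>R v)) has_real_derivative \<psi>' t) (at t)" if "0 \<le> t" "t \<le> h" for t
    unfolding \<psi>'_def using near [OF that] r'
    by (intro has_real_derivative_line smooth_on_differentiable [OF u]) auto
  from MVT2 [OF \<open>h > 0\<close> this] obtain t where t: "0 < t" "t < h"
    "u (y + h *\<^sub>R v) - u (y + 0 *\<^sub>R v) = (h - 0) * \<psi>' t" by blast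
  have "\<psi>' t < 0" using d(2) [of t] t \<open>h < d\<close> \<open>\<psi>' 0 = 0\<close> by simp
  then have "u (y + h *\<^sub>R v) < u y"
    using t(3) mult_pos_neg [OF \<open>h > 0\<close>] by fastforce
  moreover have "y + h *\<^sub>R v \<in> ball y r"
    using near [of h] \<open>h > 0\<close> by auto
  ultimately show False using min by fastforce
qed

context coord_metric
begin

lemma G_inv_factor:
  assumes x: "x \<in> S"
  obtains A :: "real^'n^'n" where "matrix_inv (G x) = A ** transpose A"
proof -
  obtain A :: "real^'n^'n" where A: "transpose A ** G x ** A = mat 1"
    using ex_orthonormal_frame [OF sym_G [OF x] pos_G [OF x]] by blast
  then have "A ** (transpose A ** G x) = mat 1"
    by (rule matrix_left_right_inverse1)
  then have "A ** transpose A ** (G x ** matrix_inv (G x)) = matrix_inv (G x)"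
    by (simp add: matrix_mul_assoc)
  then have "matrix_inv (G x) = A ** transpose A"
    by (simp add: invertible_matrix_inv(1) invertible_G x)
  then show thesis by (rule that)
qed

text \<open>Writing the inverse metric as \<open>A ** transpose A\<close> turns the trace into a sum of values of the quadratic form \<open>t\<close> on
  the columns of \<open>A\<close>.\<close>

lemma trace_nonneg:
  assumes x: "x \<in> S" and t: "\<And>v. (\<Sum>i\<in>UNIV. \<Sum>j\<in>UNIV. v $ i * v $ j * t i j) \<ge> 0"
  shows "(\<Sum>i\<in>UNIV. \<Sum>j\<in>UNIV. matrix_inv (G x) $ i $ j * t i j) \<ge> 0"
proof -
  obtain A :: "real^'n^'n" where A: "matrix_inv (G x) = A ** transpose A"
    using G_inv_factor [OF x] .
  have "(\<Sum>i\<in>UNIV. \<Sum>j\<in>UNIV. matrix_inv (G x) $ i $ j * t i j)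
      = (\<Sum>i\<in>UNIV. \<Sum>j\<in>UNIV. \<Sum>k\<in>UNIV. column k A $ i * column k A $ j * t i j)"
    by (simp add: A matrix_matrix_mult_def transpose_def column_def sum_distrib_right)
  also have "\<dots> = (\<Sum>k\<in>UNIV. \<Sum>i\<in>UNIV. \<Sum>j\<in>UNIV. column k A $ i * column k A $ j * t i j)"
    by (rule sum3_rotate)
  also have "\<dots> \<ge> 0" by (intro sum_nonneg t)
  finally show ?thesis .
qed

lemma G_inv_pos:
  assumes x: "x \<in> S" and v: "v \<noteq> 0"
  shows "(\<Sum>i\<in>UNIV. \<Sum>j\<in>UNIV. matrix_inv (G x) $ i $ j * (v $ i * v $ j)) > 0"
proof -
  define w where "w = matrix_inv (G x) *v v"
  have v_eq: "v = G x *v w"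
    by (simp add: w_def matrix_vector_mul_assoc invertible_matrix_inv(1) invertible_G x)
  then have "w \<noteq> 0" using v by auto
  have "(\<Sum>i\<in>UNIV. \<Sum>j\<in>UNIV. matrix_inv (G x) $ i $ j * (v $ i * v $ j)) = v \<bullet> w"
    by (simp add: inner_vec_def w_def matrix_vector_mult_def sum_distrib_left mult_ac)
  also have "\<dots> = w \<bullet> (G x *v w)"
    by (subst v_eq) (rule inner_commute)
  finally show ?thesis using pos_G [OF x \<open>w \<noteq> 0\<close>] by simp
qed

text \<open>Minimum principle for \<open>L u = \<Sum> g\<^sup>i\<^sup>j \<partial>\<^sub>i \<partial>\<^sub>j u + \<Sum> b\<^sub>k \<partial>\<^sub>k u - c u\<close> in its crudest form: a function with
  \<open>L w < 0\<close> has no local minimum with a value \<open>\<le> 0\<close>.\<close>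

lemma operator_nonneg_at_min:
  assumes w: "smooth_on T w" "open T" and y: "y \<in> S" "y \<in> T" and c: "c \<ge> 0" and neg: "w y \<le> 0"
    and r: "r > 0" and min: "\<And>x. x \<in> ball y r \<Longrightarrow> w y \<le> w x"
  shows "(\<Sum>i\<in>UNIV. \<Sum>j\<in>UNIV. matrix_inv (G y) $ i $ j * \<partial> i (\<partial> j w) y)
    + (\<Sum>k\<in>UNIV. b k y * \<partial> k w y) - c * w y \<ge> 0"
proof -
  have "(\<Sum>i\<in>UNIV. \<Sum>j\<in>UNIV. matrix_inv (G y) $ i $ j * \<partial> i (\<partial> j w) y) \<ge> 0"
    by (rule trace_nonneg [OF y(1) second_partial_deriv_local_min [OF w(2,1) y(2) r min]])
  moreover have "\<partial> k w y = 0" for k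
    by (rule partial_deriv_local_min [OF smooth_on_differentiable [OF w(1) y(2)] r min])
  moreover have "c * w y \<le> 0" using c neg by (simp add: mult_nonneg_nonpos)
  ultimately show ?thesis by simp
qed

text \<open>Hopf's barrier. On a compact set that avoids the centre \<open>q\<close>, the term of order \<open>\<alpha>\<^sup>2\<close> in
  \<open>L exp (- \<alpha> |x - q|\<^sup>2)\<close> is positive by ellipticity and dominates the others once \<open>\<alpha>\<close> is large.\<close>

lemma ex_barrier:
  assumes C: "compact C" "C \<subseteq> S" "q \<notin> C" and b: "\<And>k. continuous_on S (b k)" and c: "c \<ge> 0"
  obtains \<alpha> :: real and h where
    "h = (\<lambda>x. exp (- \<alpha> * (dist q x)\<^sup>2) - exp (- \<alpha> * r\<^sup>2))" "\<alpha> > 0" "smooth_on UNIV h"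
    "\<And>x. x \<in> C \<Longrightarrow> (\<Sum>i\<in>UNIV. \<Sum>j\<in>UNIV. matrix_inv (G x) $ i $ j * \<partial> i (\<partial> j h) x)
      + (\<Sum>k\<in>UNIV. b k x * \<partial> k h x) - c * h x > 0"
proof -
  define a where "a x = (\<Sum>i\<in>UNIV. \<Sum>j\<in>UNIV. matrix_inv (G x) $ i $ j * ((x - q) $ i * (x - q) $ j))" for x
  define l where "l x = (\<Sum>i\<in>UNIV. matrix_inv (G x) $ i $ i) + (\<Sum>k\<in>UNIV. b k x * (x - q) $ k)" for x
  have cont_inv: "continuous_on C (\<lambda>x. matrix_inv (G x) $ i $ j)" for i j
    using smooth_on_continuous_on [OF smooth_G_inv] C(2) by (rule continuous_on_subset)
  have cont_a: "continuous_on C a"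
    unfolding a_def by (intro continuous_intros cont_inv)
  have cont_l: "continuous_on C l"
    unfolding l_def by (intro continuous_intros cont_inv continuous_on_subset [OF b C(2)])
  have "\<exists>\<mu>>0. \<forall>x\<in>C. \<mu> \<le> a x"
  proof (cases "C = {}")
    case False
    then obtain x where x: "x \<in> C" "\<And>y. y \<in> C \<Longrightarrow> a x \<le> a y"
      using continuous_attains_inf [OF C(1) _ cont_a] by blast
    have "a x > 0"
      unfolding a_def using x(1) C by (intro G_inv_pos) auto
    then show ?thesis using x by blast
  qed (auto intro: exI [of _ 1])
  then obtain \<mu> where \<mu>: "\<mu> > 0" "\<And>x. x \<in> C \<Longrightarrow> \<mu> \<le> a x" by blast
  have "bounded (l ` C)"
    by (intro compact_imp_bounded compact_continuous_image cont_l C)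
  then obtain K where K: "K > 0" "\<And>x. x \<in> C \<Longrightarrow> \<bar>l x\<bar> \<le> K"
    unfolding bounded_pos by auto
  \<comment> \<open>\<open>\<mu>\<close> is the ellipticity constant and \<open>K\<close> bounds the terms that are linear in \<open>\<alpha>\<close>. This choice
    gives \<open>4 \<alpha>\<^sup>2 \<mu> \<ge> 4 \<alpha> (K + c + 1) > 2 \<alpha> K + c\<close>.\<close>
  define \<alpha> where "\<alpha> = max 1 ((K + c + 1) / \<mu>)"
  have \<alpha>: "\<alpha> \<ge> 1" "\<alpha> * \<mu> \<ge> K + c + 1"
    using \<mu>(1) by (auto simp: \<alpha>_def max_def field_simps)
  define N where "N x = (\<Sum>k\<in>UNIV. (x $ k - q $ k) * (x $ k - q $ k))" for x
  have N: "(dist q x)\<^sup>2 = N x" for x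
    by (subst dist_commute) (simp add: N_def dist_norm power2_norm_eq_inner inner_vec_def)
  define E where "E x = exp (- \<alpha> * N x)" for x
  define h where "h x = E x - exp (- \<alpha> * r\<^sup>2)" for x
  have smooth_d: "smooth_on UNIV (\<lambda>x. x $ k - q $ k)" for k
    by (intro smooth_on_diff smooth_on_nth smooth_on_const open_UNIV)
  have smooth_N: "smooth_on UNIV N"
    unfolding N_def by (intro smooth_on_sum smooth_on_mult smooth_d open_UNIV finite)
  have smooth_E: "smooth_on UNIV E"
    unfolding E_def by (intro smooth_on_exp smooth_on_mult smooth_on_const smooth_N open_UNIV)
  have smooth_h: "smooth_on UNIV h"
    unfolding h_def by (intro smooth_on_diff smooth_on_const smooth_E open_UNIV)
  note diff = smooth_on_differentiable [OF smooth_d UNIV_I] smooth_on_differentiable [OF smooth_N UNIV_I]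
    smooth_on_differentiable [OF smooth_E UNIV_I]
  have dd: "\<partial> i (\<lambda>x. x $ k - q $ k) x = (if i = k then 1 else 0)" for i k x
    by (simp add: partial_deriv_diff partial_deriv_nth
        bounded_linear_imp_differentiable bounded_linear_vec_nth)
  have dN: "\<partial> i N x = 2 * (x $ i - q $ i)" for i x
  proof -
    have "\<partial> i N x = (\<Sum>k\<in>UNIV. (if i = k then 1 else 0) * (x $ k - q $ k) + (x $ k - q $ k) * (if i = k then 1 else 0))"
      unfolding N_def by (simp only: partial_deriv_sum partial_deriv_mult differentiable_mult diff dd)
    also have "\<dots> = (\<Sum>k\<in>UNIV. if i = k then 2 * (x $ k - q $ k) else 0)"
      by (intro sum.cong) auto
    finally have "\<partial> i N x = \<dots>" .
    then show ?thesis by simp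
  qed
  have dE: "\<partial> i E = (\<lambda>x. - 2 * \<alpha> * ((x $ i - q $ i) * E x))" for i
    unfolding E_def
    by (rule ext, subst partial_deriv_exp) (simp_all add: partial_deriv_minus partial_deriv_cmult diff dN)
  have dh: "\<partial> i h = \<partial> i E" for i
    unfolding h_def by (rule ext) (simp add: partial_deriv_diff diff)
  have ddh: "\<partial> i (\<partial> j h) x = (4 * \<alpha>\<^sup>2 * ((x $ i - q $ i) * (x $ j - q $ j)) - 2 * \<alpha> * (if i = j then 1 else 0)) * E x" for i j x
    unfolding dh dE [of j]
    by (subst partial_deriv_cmult, intro differentiable_mult diff, subst partial_deriv_mult, rule diff, rule diff)
      (simp add: dd dE power2_eq_square algebra_simps)
  have "(\<Sum>i\<in>UNIV. \<Sum>j\<in>UNIV. matrix_inv (G x) $ i $ j * \<partial> i (\<partial> j h) x)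
      + (\<Sum>k\<in>UNIV. b k x * \<partial> k h x) - c * h x > 0" (is "?L x > 0") if x: "x \<in> C" for x
  proof -
    have E: "E x > 0" by (simp add: E_def)
    have "(\<Sum>i\<in>UNIV. \<Sum>j\<in>UNIV. matrix_inv (G x) $ i $ j * \<partial> i (\<partial> j h) x)
      = (\<Sum>i\<in>UNIV. \<Sum>j\<in>UNIV. 4 * \<alpha>\<^sup>2 * E x * (matrix_inv (G x) $ i $ j * ((x - q) $ i * (x - q) $ j))
        - 2 * \<alpha> * E x * (if i = j then matrix_inv (G x) $ i $ j else 0))"
      by (intro sum.cong refl) (simp add: ddh algebra_simps)
    also have "\<dots> = 4 * \<alpha>\<^sup>2 * E x * a x - 2 * \<alpha> * E x * (\<Sum>i\<in>UNIV. matrix_inv (G x) $ i $ i)"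
      by (simp only: sum_subtractf sum_distrib_left [symmetric] a_def sum.delta' finite UNIV_I if_True)
    finally have 1: "(\<Sum>i\<in>UNIV. \<Sum>j\<in>UNIV. matrix_inv (G x) $ i $ j * \<partial> i (\<partial> j h) x)
      = 4 * \<alpha>\<^sup>2 * E x * a x - 2 * \<alpha> * E x * (\<Sum>i\<in>UNIV. matrix_inv (G x) $ i $ i)" .
    have 2: "(\<Sum>k\<in>UNIV. b k x * \<partial> k h x) = - 2 * \<alpha> * E x * (\<Sum>k\<in>UNIV. b k x * (x - q) $ k)"
      by (simp add: dh dE sum_distrib_left mult_ac)
    have "4 * \<alpha> * (K + c + 1) \<le> 4 * \<alpha> * (\<alpha> * \<mu>)"
      using \<alpha> by (intro mult_left_mono) auto
    also have "\<dots> \<le> 4 * \<alpha> * (\<alpha> * a x)"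
      using \<alpha> \<mu>(2) [OF x] by (intro mult_left_mono) auto
    finally have "4 * (\<alpha> * K) + 4 * (\<alpha> * c) + 4 * \<alpha> \<le> 4 * (\<alpha>\<^sup>2 * a x)"
      by (simp add: power2_eq_square algebra_simps)
    moreover have "\<alpha> * l x \<le> \<alpha> * K" using K(2) [OF x] \<alpha> by (intro mult_left_mono) auto
    moreover have "c \<le> \<alpha> * c" using mult_right_mono [OF \<alpha>(1) c] by simp
    moreover have "\<alpha> * K > 0" using \<alpha> K(1) by simp
    ultimately have "4 * (\<alpha>\<^sup>2 * a x) - 2 * (\<alpha> * l x) - c > 0"
      using \<alpha>(1) c by linarith
    then have "E x * (4 * (\<alpha>\<^sup>2 * a x) - 2 * (\<alpha> * l x) - c) > 0" using E by simp
    moreover have "c * exp (- \<alpha> * r\<^sup>2) \<ge> 0" using c by simp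
    ultimately show ?thesis
      unfolding 1 2 by (simp add: l_def h_def algebra_simps)
  qed
  note pos = this
  have "h = (\<lambda>x. exp (- \<alpha> * (dist q x)\<^sup>2) - exp (- \<alpha> * r\<^sup>2))"
    by (simp add: fun_eq_iff h_def E_def N)
  moreover have "\<alpha> > 0" using \<alpha>(1) by simp
  ultimately show thesis using smooth_h pos by (rule that)
qed

text \<open>If \<open>u\<close> were positive somewhere near the zero \<open>p\<close>, there would be a ball on which \<open>u > 0\<close> whose closure
  contains exactly one zero \<open>x0\<close> of \<open>u\<close>. Near \<open>x0\<close> a small multiple of the barrier \<open>h\<close> can be
  subtracted from \<open>u\<close> such that \<open>w = u - \<epsilon> h\<close> stays nonnegative on a sphere about \<open>x0\<close>, while
  \<open>w x0 = 0\<close> and \<open>L w < 0\<close> inside. So \<open>w\<close> attains a minimum \<open>\<le> 0\<close> inside, which is absurd.\<close>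

theorem strong_minimum_principle:
  assumes u: "smooth_on S u" and nonneg: "\<And>x. x \<in> S \<Longrightarrow> u x \<ge> 0"
    and b: "\<And>k. continuous_on S (b k)" and c: "c \<ge> 0"
    and super: "\<And>x. x \<in> S \<Longrightarrow> (\<Sum>i\<in>UNIV. \<Sum>j\<in>UNIV. matrix_inv (G x) $ i $ j * \<partial> i (\<partial> j u) x)
      + (\<Sum>k\<in>UNIV. b k x * \<partial> k u x) - c * u x \<le> 0"
    and p: "p \<in> S" "u p = 0"
  shows "\<exists>r>0. \<forall>x\<in>ball p r. u x = 0"
proof -
  obtain R where R: "R > 0" "cball p R \<subseteq> S"
    using open_S p(1) by (auto simp: open_contains_cball)
  have cont_u: "continuous_on T u" if "T \<subseteq> S" for T
    using smooth_on_continuous_on [OF u] that by (rule continuous_on_subset)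
  have "u q = 0" if q: "q \<in> ball p (R / 4)" for q
  proof (rule ccontr)
    assume "u q \<noteq> 0"
    define Z where "Z = {x \<in> cball p R. u x = 0}"
    have "closed Z"
      unfolding Z_def by (rule continuous_closed_preimage_constant [OF cont_u [OF R(2)] closed_cball])
    moreover have "bounded Z"
      by (rule bounded_subset [OF bounded_cball, of _ p R]) (auto simp: Z_def)
    ultimately have "compact Z" by (simp add: compact_eq_bounded_closed)
    moreover have "p \<in> Z" using p R by (simp add: Z_def)
    moreover have "continuous_on Z (dist q)" by (intro continuous_intros)
    ultimately obtain x0 where x0: "x0 \<in> Z" "\<And>x. x \<in> Z \<Longrightarrow> dist q x0 \<le> dist q x"
      using continuous_attains_inf [of Z "dist q"] by blast
    \<comment> \<open>The open ball about \<open>q\<close> through \<open>x0\<close> contains no zero. The ball about the midpoint \<open>m\<close> of \<open>q\<close> and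
      \<open>x0\<close> touches its boundary from inside, hence meets the zeros in \<open>x0\<close> only.\<close>
    define r where "r = dist q x0 / 2"
    define m where "m = (1 / 2) *\<^sub>R (q + x0)"
    have "x0 \<noteq> q" using x0(1) \<open>u q \<noteq> 0\<close> by (auto simp: Z_def)
    then have "r > 0" by (simp add: r_def)
    have r_small: "2 * r < R / 4"
      using x0(2) [OF \<open>p \<in> Z\<close>] q by (simp add: r_def dist_commute)
    have x0_near: "dist p x0 < R / 2"
      using dist_triangle [of p x0 q] q r_small by (simp add: r_def)
    have "m - x0 = (1 / 2) *\<^sub>R (q - x0)"
      by (simp add: m_def vec_eq_iff field_simps)
    then have m_x0: "dist m x0 = r"
      by (simp add: r_def dist_norm)
    have touch: "x = x0" if x: "x \<in> Z" "dist m x \<le> r" for x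
    proof -
      have "(2 * r)\<^sup>2 \<le> (norm (x - q))\<^sup>2"
        using x0(2) [OF x(1)] \<open>r > 0\<close> by (intro power_mono) (auto simp: r_def dist_norm norm_minus_commute)
      moreover have "(norm (x - m))\<^sup>2 \<le> r\<^sup>2"
        using x(2) by (intro power_mono) (auto simp: dist_norm norm_minus_commute)
      moreover have "(norm (x0 - q))\<^sup>2 = (2 * r)\<^sup>2"
        by (simp add: r_def dist_norm norm_minus_commute)
      \<comment> \<open>the parallelogram law\<close>
      moreover have "4 * (norm (x - m))\<^sup>2 = 2 * (norm (x - q))\<^sup>2 + 2 * (norm (x - x0))\<^sup>2 - (norm (x0 - q))\<^sup>2"
        by (simp add: m_def power2_norm_eq_inner inner_diff_left inner_diff_right inner_add_left
            inner_add_right inner_commute algebra_simps)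
      moreover have "(2 * r)\<^sup>2 = 4 * r\<^sup>2" by (simp add: power_mult_distrib)
      ultimately have "(norm (x - x0))\<^sup>2 \<le> 0" by linarith
      then show ?thesis by simp
    qed
    \<comment> \<open>The barrier is used on a ball about \<open>x0\<close> that stays away from its centre \<open>m\<close>.\<close>
    define s where "s = r / 2"
    have s: "0 < s" "s < r" using \<open>r > 0\<close> by (auto simp: s_def)
    have sub: "cball x0 s \<subseteq> cball p R"
    proof
      fix x assume "x \<in> cball x0 s"
      then show "x \<in> cball p R"
        using dist_triangle [of p x x0] x0_near r_small \<open>r > 0\<close> by (simp add: s_def)
    qed
    then have sub_S: "cball x0 s \<subseteq> S" using R by blast
    have m_out: "m \<notin> cball x0 s"
      using m_x0 s by (simp add: dist_commute)
    obtain \<alpha> h where h: "h = (\<lambda>x. exp (- \<alpha> * (dist m x)\<^sup>2) - exp (- \<alpha> * r\<^sup>2))" "\<alpha> > 0"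
      and smooth_h: "smooth_on UNIV h"
      and Lh: "\<And>x. x \<in> cball x0 s \<Longrightarrow> (\<Sum>i\<in>UNIV. \<Sum>j\<in>UNIV. matrix_inv (G x) $ i $ j * \<partial> i (\<partial> j h) x)
        + (\<Sum>k\<in>UNIV. b k x * \<partial> k h x) - c * h x > 0"
      by (rule ex_barrier [where b = b and r = r, OF compact_cball sub_S m_out b c], rule that)
    have h_x0: "h x0 = 0" by (simp add: h m_x0)
    have h_le: "h x \<le> 1" for x
    proof -
      have "exp (- \<alpha> * (dist m x)\<^sup>2) \<le> 1" using h(2) by simp
      moreover have "exp (- \<alpha> * r\<^sup>2) > 0" by simp
      ultimately show ?thesis unfolding h(1) by linarith
    qed
    have h_outside: "h x \<le> 0" if "dist m x \<ge> r" for x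
      using h(2) that \<open>r > 0\<close> by (simp add: h(1) power_mono)
    \<comment> \<open>The barrier is positive only inside the ball about \<open>m\<close>; on that part of the sphere \<open>u\<close> is
      bounded below by a positive constant, as its only zero there could be \<open>x0\<close>, the centre of the sphere.\<close>
    have "\<exists>\<epsilon>>0. \<forall>x\<in>sphere x0 s \<inter> cball m r. \<epsilon> \<le> u x"
    proof (cases "sphere x0 s \<inter> cball m r = {}")
      case False
      have "compact (sphere x0 s \<inter> cball m r)" by (intro compact_Int compact_sphere compact_cball)
      moreover have "continuous_on (sphere x0 s \<inter> cball m r) u"
        using sub_S by (intro cont_u) auto
      ultimately obtain y where y: "y \<in> sphere x0 s \<inter> cball m r"
        "\<And>x. x \<in> sphere x0 s \<inter> cball m r \<Longrightarrow> u y \<le> u x"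
        using continuous_attains_inf False by meson
      have "y \<in> cball p R" using y(1) sub by auto
      moreover have "u y \<noteq> 0"
        using touch [of y] y(1) \<open>y \<in> cball p R\<close> s by (auto simp: Z_def)
      ultimately have "u y > 0"
        using nonneg [of y] R by force
      then show ?thesis using y(2) by blast
    qed (auto intro: exI [of _ 1])
    then obtain \<epsilon> where \<epsilon>: "\<epsilon> > 0" "\<And>x. x \<in> sphere x0 s \<inter> cball m r \<Longrightarrow> \<epsilon> \<le> u x" by blast
    define w where "w x = u x - \<epsilon> * h x" for x
    have smooth_h': "smooth_on S h" using smooth_h by (rule smooth_on_subset) simp
    have smooth_w: "smooth_on S w"
      unfolding w_def by (intro smooth_on_diff smooth_on_mult smooth_on_const u smooth_h' open_S)
    have w_x0: "w x0 = 0" using x0 by (simp add: w_def h_x0 Z_def)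
    have w_sphere: "w x \<ge> 0" if x: "x \<in> sphere x0 s" for x
    proof (cases "dist m x \<ge> r")
      case True
      moreover have "u x \<ge> 0" using x sub_S by (intro nonneg) auto
      moreover have "\<epsilon> * h x \<le> 0"
        using h_outside [OF True] \<epsilon>(1) by (simp add: mult_nonneg_nonpos)
      ultimately show ?thesis by (simp add: w_def)
    next
      case False
      then have "\<epsilon> \<le> u x" using x by (intro \<epsilon>(2)) auto
      moreover have "\<epsilon> * h x \<le> \<epsilon> * 1" using h_le \<epsilon>(1) by (intro mult_left_mono) auto
      ultimately show ?thesis by (simp add: w_def)
    qed
    obtain y0 where y0: "y0 \<in> cball x0 s" "\<And>x. x \<in> cball x0 s \<Longrightarrow> w y0 \<le> w x"
      using continuous_attains_inf [OF compact_cball, of x0 s w] s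
        continuous_on_subset [OF smooth_on_continuous_on [OF smooth_w] sub_S] by auto
    \<comment> \<open>If the minimum lies on the sphere, then its value is 0 and the centre is a minimum too.\<close>
    obtain y where y: "y \<in> ball x0 s" "\<And>x. x \<in> cball x0 s \<Longrightarrow> w y \<le> w x"
    proof (cases "y0 \<in> ball x0 s")
      case True
      then show ?thesis using that y0 by blast
    next
      case False
      then have "w y0 \<ge> 0" using y0 by (intro w_sphere) auto
      then have "w x0 \<le> w x" if "x \<in> cball x0 s" for x
        using y0(2) [OF that] w_x0 by simp
      then show ?thesis using that [of x0] s by auto
    qed
    have "w y \<le> 0" using y(2) [of x0] w_x0 s by simp
    obtain e where e: "e > 0" "ball y e \<subseteq> ball x0 s"
      using y(1) open_ball open_contains_ball by metis
    have yS: "y \<in> S" using y(1) sub_S by auto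
    have "(\<Sum>i\<in>UNIV. \<Sum>j\<in>UNIV. matrix_inv (G y) $ i $ j * \<partial> i (\<partial> j w) y)
        + (\<Sum>k\<in>UNIV. b k y * \<partial> k w y) - c * w y \<ge> 0"
      using e y(2) by (intro operator_nonneg_at_min [OF smooth_w open_S yS yS c \<open>w y \<le> 0\<close> e(1)]) auto
    moreover have "\<partial> i (\<partial> j w) y = \<partial> i (\<partial> j u) y - \<epsilon> * \<partial> i (\<partial> j h) y" for i j
      using second_partial_mult [OF open_S yS smooth_on_const smooth_h', of i j \<epsilon>] open_S
      by (simp add: w_def [abs_def] second_partial_diff [OF open_S yS u smooth_on_mult]
          smooth_on_const smooth_h' partial_deriv_const [abs_def])
    moreover have "\<partial> k w y = \<partial> k u y - \<epsilon> * \<partial> k h y" for k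
      using smooth_on_differentiable [OF u yS] smooth_on_differentiable [OF smooth_h' yS]
      by (simp add: w_def [abs_def] partial_deriv_diff partial_deriv_cmult)
    ultimately have "((\<Sum>i\<in>UNIV. \<Sum>j\<in>UNIV. matrix_inv (G y) $ i $ j * \<partial> i (\<partial> j u) y)
        + (\<Sum>k\<in>UNIV. b k y * \<partial> k u y) - c * u y)
      - \<epsilon> * ((\<Sum>i\<in>UNIV. \<Sum>j\<in>UNIV. matrix_inv (G y) $ i $ j * \<partial> i (\<partial> j h) y)
        + (\<Sum>k\<in>UNIV. b k y * \<partial> k h y) - c * h y) \<ge> 0"
      by (simp add: w_def right_diff_distrib ring_distribs sum_subtractf sum_distrib_left mult_ac)
    moreover have "\<epsilon> * ((\<Sum>i\<in>UNIV. \<Sum>j\<in>UNIV. matrix_inv (G y) $ i $ j * \<partial> i (\<partial> j h) y)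
        + (\<Sum>k\<in>UNIV. b k y * \<partial> k h y) - c * h y) > 0"
      using Lh [of y] y(1) \<epsilon>(1) by (intro mult_pos_pos) auto
    ultimately show False using super [OF yS] by linarith
  qed
  then show ?thesis
    using R(1) by (intro exI [of _ "R / 4"]) auto
qed

end

section \<open>The scalar curvature of a gradient Yamabe soliton in a chart\<close>

context coord_metric
begin

text \<open>At a negative local minimum of \<open>R\<close> the gradient term of the scalar curvature equation vanishes,
  the Laplacian is nonnegative, and \<open>R (R - \<rho>)\<close> is positive.\<close>

lemma soliton_no_negative_min:
  assumes F: "smooth_on S F"
    and eq: "\<And>y i j. y \<in> S \<Longrightarrow> hessian G F i j y = (scalar_coord G y - \<rho>) * G y $ i $ j"
    and \<rho>: "\<rho> \<ge> 0" and p: "p \<in> S" and r: "r > 0"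
    and min: "\<And>x. x \<in> ball p r \<Longrightarrow> scalar_coord G p \<le> scalar_coord G x"
  shows "scalar_coord G p \<ge> 0"
proof (rule ccontr)
  assume neg: "\<not> ?thesis"
  have grad: "\<partial> k (scalar_coord G) p = 0" for k
    by (rule partial_deriv_local_min [OF smooth_on_differentiable [OF smooth_scalar_coord p] r min])
  have "(\<Sum>a\<in>UNIV. \<Sum>b\<in>UNIV. matrix_inv (G p) $ a $ b * \<partial> a (\<partial> b (scalar_coord G)) p) \<ge> 0"
    by (rule trace_nonneg [OF p second_partial_deriv_local_min [OF open_S smooth_scalar_coord p r min]])
  then have "(real CARD('n) - 1) *
      (\<Sum>a\<in>UNIV. \<Sum>b\<in>UNIV. matrix_inv (G p) $ a $ b * hessian G (scalar_coord G) a b p) \<ge> 0"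
    by (intro mult_nonneg_nonneg) (simp_all add: hessian_def grad Suc_le_eq)
  moreover have "scalar_coord G p * (scalar_coord G p - \<rho>) > 0"
    using neg \<rho> by (intro mult_neg_neg) auto
  ultimately show False
    using soliton_scalar_equation [OF F eq p] by (simp add: grad)
qed

lemma scalar_coord_dim_1:
  assumes "CARD('n) = 1"
  shows "scalar_coord G x = 0"
proof -
  obtain a :: 'n where "UNIV = {a}"
    using assms card_1_singletonE by blast
  then have a: "i = a" for i by auto
  have "riemann G l k i j x = 0" for l k i j
    unfolding a [of i] a [of j] by (simp add: riemann_def)
  then show ?thesis by (simp add: scalar_coord_def ricci_def)
qed

text \<open>By the equation for the scalar curvature \<open>R\<close>, the operator
  \<open>u \<mapsto> (n - 1) \<Delta>u + \<langle>\<nabla>F, \<nabla>u\<rangle> / 2 - \<rho> u\<close> maps \<open>R\<close> to \<open>- R\<^sup>2 \<le> 0\<close>, and \<open>\<rho> \<ge> 0\<close> is the sign of the zeroth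
  order term that the strong minimum principle asks for. In dimension 1 the operator is not elliptic,
  but there \<open>R\<close> vanishes identically.\<close>

lemma soliton_zero_set_open:
  assumes F: "smooth_on S F"
    and eq: "\<And>y i j. y \<in> S \<Longrightarrow> hessian G F i j y = (scalar_coord G y - \<rho>) * G y $ i $ j"
    and \<rho>: "\<rho> \<ge> 0" and nonneg: "\<And>x. x \<in> S \<Longrightarrow> scalar_coord G x \<ge> 0"
    and p: "p \<in> S" "scalar_coord G p = 0"
  shows "\<exists>r>0. \<forall>x\<in>ball p r. scalar_coord G x = 0"
proof (cases "CARD('n) = 1")
  case True
  then show ?thesis using scalar_coord_dim_1 by (intro exI [of _ 1]) simp
next
  case False
  define N where "N = real CARD('n) - 1"
  have "CARD('n) > 0" by simp
  with False have "CARD('n) > 1" by linarith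
  then have "N > 0" by (simp add: N_def)
  define b where "b k x = (\<Sum>j\<in>UNIV. matrix_inv (G x) $ k $ j * \<partial> j F x) / (2 * N)
    - (\<Sum>i\<in>UNIV. \<Sum>j\<in>UNIV. matrix_inv (G x) $ i $ j * christoffel G k i j x)" for k x
  show ?thesis
  proof (rule strong_minimum_principle [where b = b and c = "\<rho> / N", OF smooth_scalar_coord nonneg _ _ _ p])
    show "continuous_on S (b k)" for k
      unfolding b_def using \<open>N > 0\<close>
      by (intro continuous_intros smooth_on_continuous_on smooth_G_inv smooth_christoffel
          smooth_on_partial_deriv F) auto
    show "\<rho> / N \<ge> 0" using \<rho> \<open>N > 0\<close> by simp
    fix x assume x: "x \<in> S"
    define R where "R = scalar_coord G x"
    define H where "H = (\<Sum>i\<in>UNIV. \<Sum>j\<in>UNIV. matrix_inv (G x) $ i $ j * \<partial> i (\<partial> j (scalar_coord G)) x)"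
    define C where "C = (\<Sum>k\<in>UNIV. (\<Sum>i\<in>UNIV. \<Sum>j\<in>UNIV. matrix_inv (G x) $ i $ j * christoffel G k i j x)
      * \<partial> k (scalar_coord G) x)"
    define P where "P = (\<Sum>i\<in>UNIV. \<Sum>j\<in>UNIV. matrix_inv (G x) $ i $ j * (\<partial> i (scalar_coord G) x * \<partial> j F x))"
    have "(\<Sum>i\<in>UNIV. \<Sum>j\<in>UNIV. matrix_inv (G x) $ i $ j * hessian G (scalar_coord G) i j x)
      = H - (\<Sum>i\<in>UNIV. \<Sum>j\<in>UNIV. \<Sum>k\<in>UNIV. matrix_inv (G x) $ i $ j * christoffel G k i j x * \<partial> k (scalar_coord G) x)"
      by (simp add: hessian_def H_def right_diff_distrib sum_subtractf sum_distrib_left mult.assoc)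
    also have "(\<Sum>i\<in>UNIV. \<Sum>j\<in>UNIV. \<Sum>k\<in>UNIV. matrix_inv (G x) $ i $ j * christoffel G k i j x * \<partial> k (scalar_coord G) x)
      = C"
      unfolding C_def by (subst sum3_rotate) (simp add: sum_distrib_right)
    finally have soliton: "N * (H - C) + P / 2 + R * (R - \<rho>) = 0"
      using soliton_scalar_equation [OF F eq x] by (simp add: N_def P_def R_def)
    have "(\<Sum>j\<in>UNIV. matrix_inv (G x) $ k $ j * \<partial> j F x) * \<partial> k (scalar_coord G) x
      = (\<Sum>j\<in>UNIV. matrix_inv (G x) $ k $ j * (\<partial> k (scalar_coord G) x * \<partial> j F x))" for k
      by (simp add: sum_distrib_left mult_ac)
    then have drift: "(\<Sum>k\<in>UNIV. b k x * \<partial> k (scalar_coord G) x) = P / (2 * N) - C"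
      by (simp add: b_def P_def C_def left_diff_distrib sum_subtractf flip: sum_divide_distrib)
    have scaled: "N * (H + (P / (2 * N) - C) - \<rho> / N * R) = N * (H - C) + P / 2 - \<rho> * R"
      using \<open>N > 0\<close> by (simp add: field_simps)
    have "N * (H + (\<Sum>k\<in>UNIV. b k x * \<partial> k (scalar_coord G) x) - \<rho> / N * R) = - (R * R)"
      unfolding drift scaled using soliton by (simp add: algebra_simps)
    then have "N * (H + (\<Sum>k\<in>UNIV. b k x * \<partial> k (scalar_coord G) x) - \<rho> / N * R) \<le> 0"
      by simp
    then show "H + (\<Sum>k\<in>UNIV. b k x * \<partial> k (scalar_coord G) x) - \<rho> / N * R \<le> 0"
      using \<open>N > 0\<close> by (simp add: mult_le_0_iff)
  qed
qed

end

section \<open>From charts to the manifold\<close>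

lemma is_chartD:
  assumes "is_chart c"
  shows "open (fst c)" "open (chart_image c)"
    "p \<in> fst c \<Longrightarrow> snd c p \<in> chart_image c" "p \<in> fst c \<Longrightarrow> chart_inv c (snd c p) = p"
    "x \<in> chart_image c \<Longrightarrow> chart_inv c x \<in> fst c" "x \<in> chart_image c \<Longrightarrow> snd c (chart_inv c x) = x"
    "continuous_on (fst c) (snd c)" "continuous_on (chart_image c) (chart_inv c)"
  using assms by (auto simp: is_chart_def homeomorphism_def)

lemma coord_metric_subset:
  assumes "coord_metric S G" "open T" "T \<subseteq> S"
  shows "coord_metric T G"
proof -
  interpret coord_metric S G by fact
  show ?thesis
    using assms smooth_on_subset [OF smooth_G] sym_G pos_G by unfold_locales auto
qed

locale riemannian_manifold =
  fixes A :: "('a::t2_space, 'n::finite) chart set" and g :: "('a, 'n) metric"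
  assumes atlas: "smooth_atlas A" and metric: "riemannian_metric A g"
begin

lemma chart: "c \<in> A \<Longrightarrow> is_chart c"
  using atlas by (simp add: smooth_atlas_def)

lemma ex_chart: obtains c where "c \<in> A" "p \<in> fst c"
  using atlas unfolding smooth_atlas_def by blast

lemma coord_metric_chart: "c \<in> A \<Longrightarrow> coord_metric (chart_image c) (g c)"
  using metric is_chartD(2) [OF chart] by unfold_locales (auto simp: riemannian_metric_def)

lemma metric_pullback_transition:
  assumes c: "c \<in> A" and d: "d \<in> A"
  shows "metric_pullback (snd c ` (fst c \<inter> fst d)) (g c) (chart_image d) (g d) (transition c d)"
proof -
  note C = is_chartD [OF chart [OF c]] and D = is_chartD [OF chart [OF d]]
  have "snd c ` (fst c \<inter> fst d) = chart_image c \<inter> chart_inv c -` fst d"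
    using C(3-6) by (force simp: image_iff)
  then have "open (snd c ` (fst c \<inter> fst d))" "snd c ` (fst c \<inter> fst d) \<subseteq> chart_image c"
    using continuous_open_preimage [OF C(8,2) D(1)] by auto
  then have src: "coord_metric (snd c ` (fst c \<inter> fst d)) (g c)"
    by (rule coord_metric_subset [OF coord_metric_chart [OF c]])
  show ?thesis
  proof (intro metric_pullback.intro metric_pullback_axioms.intro src coord_metric_chart [OF d])
    show "smooth_on (snd c ` (fst c \<inter> fst d)) (\<lambda>x. transition c d x $ k)" for k
      using atlas c d by (simp add: smooth_atlas_def)
    fix x assume x: "x \<in> snd c ` (fst c \<inter> fst d)"
    then show "transition c d x \<in> chart_image d"
      using C(4) D(3) by (auto simp: transition_def)
    show "g c x = transpose (jacobian (transition c d) (at x)) ** g d (transition c d x)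
        ** jacobian (transition c d) (at x)"
      by (rule metric [unfolded riemannian_metric_def Let_def, THEN conjunct2, THEN conjunct2,
            THEN conjunct2, rule_format, OF c d x])
  qed
qed

text \<open>The definition picks an arbitrary chart at each point separately. Only independence of the choice
  shows that the result is smooth.\<close>

lemma scalar_curvature_chart:
  assumes c: "c \<in> A" and p: "p \<in> fst c"
  shows "scalar_curvature A g p = scalar_coord (g c) (snd c p)"
proof -
  define d where "d = (SOME d. d \<in> A \<and> p \<in> fst d)"
  have d: "d \<in> A \<and> p \<in> fst d"
    unfolding d_def by (rule someI [of "\<lambda>d. d \<in> A \<and> p \<in> fst d" c]) (simp add: c p)
  interpret metric_pullback "snd d ` (fst d \<inter> fst c)" "g d" "chart_image c" "g c" "transition d c"
    using d c by (intro metric_pullback_transition) auto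
  have "scalar_curvature A g p = scalar_coord (g d) (snd d p)"
    by (simp add: scalar_curvature_def Let_def d_def)
  also have "\<dots> = scalar_coord (g c) (transition d c (snd d p))"
    using d p by (intro scalar_coord_pullback) auto
  also have "transition d c (snd d p) = snd c p"
    using d is_chartD(4) [OF chart] by (simp add: transition_def)
  finally show ?thesis .
qed

lemma continuous_scalar_curvature: "continuous_on UNIV (scalar_curvature A g)"
proof (rule continuous_at_imp_continuous_on, rule ballI)
  fix p :: 'a
  obtain c where c: "c \<in> A" "p \<in> fst c" by (rule ex_chart)
  note C = is_chartD [OF chart [OF c(1)]]
  interpret coord_metric "chart_image c" "g c" by (rule coord_metric_chart [OF c(1)])
  have "continuous_on (fst c) (\<lambda>p. scalar_coord (g c) (snd c p))"
    by (rule continuous_on_compose2 [OF smooth_on_continuous_on [OF smooth_scalar_coord] C(7)])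
      (auto simp: C(3))
  then have "continuous_on (fst c) (scalar_curvature A g)"
    using scalar_curvature_chart [OF c(1)] by (simp cong: continuous_on_cong)
  then show "isCont (scalar_curvature A g) p"
    using C(1) c(2) by (simp add: continuous_on_eq_continuous_at)
qed

end

locale yamabe_soliton = riemannian_manifold A g
  for A :: "('a::t2_space, 'n::finite) chart set" and g +
  fixes f :: "'a \<Rightarrow> real" and \<rho> :: real
  assumes soliton: "gradient_yamabe_soliton A g f \<rho>" and \<rho>_nonneg: "\<rho> \<ge> 0"
begin

lemma smooth_potential: "c \<in> A \<Longrightarrow> smooth_on (chart_image c) (f \<circ> chart_inv c)"
  using soliton by (simp add: gradient_yamabe_soliton_def smooth_function_def)

lemma soliton_chart:
  assumes c: "c \<in> A" and x: "x \<in> chart_image c"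
  shows "hessian (g c) (f \<circ> chart_inv c) i j x = (scalar_coord (g c) x - \<rho>) * g c x $ i $ j"
  using soliton c is_chartD(5,6) [OF chart [OF c] x] scalar_curvature_chart [OF c, of "chart_inv c x"]
  unfolding gradient_yamabe_soliton_def by metis

lemma no_negative_global_min:
  assumes min: "\<And>p. scalar_curvature A g q \<le> scalar_curvature A g p"
  shows "scalar_curvature A g q \<ge> 0"
proof -
  obtain c where c: "c \<in> A" "q \<in> fst c" by (rule ex_chart)
  note C = is_chartD [OF chart [OF c(1)]]
  interpret coord_metric "chart_image c" "g c" by (rule coord_metric_chart [OF c(1)])
  obtain r where r: "r > 0" "ball (snd c q) r \<subseteq> chart_image c"
    using C(2,3) c(2) by (meson open_contains_ball)
  have "scalar_coord (g c) (snd c q) \<le> scalar_coord (g c) x" if "x \<in> ball (snd c q) r" for x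
    using min [of "chart_inv c x"] that r(2) C(5,6) [of x]
    by (auto simp: scalar_curvature_chart [OF c(1)] c(2))
  from soliton_no_negative_min [OF smooth_potential [OF c(1)] soliton_chart [OF c(1)] \<rho>_nonneg
      C(3) [OF c(2)] r(1) this]
  show ?thesis by (simp add: scalar_curvature_chart [OF c])
qed

lemma open_zero_set:
  assumes nonneg: "\<And>p. scalar_curvature A g p \<ge> 0"
  shows "open {p. scalar_curvature A g p = 0}"
proof (subst open_subopen, intro ballI)
  fix p assume p: "p \<in> {p. scalar_curvature A g p = 0}"
  obtain c where c: "c \<in> A" "p \<in> fst c" by (rule ex_chart)
  note C = is_chartD [OF chart [OF c(1)]]
  interpret coord_metric "chart_image c" "g c" by (rule coord_metric_chart [OF c(1)])
  have "scalar_coord (g c) x \<ge> 0" if "x \<in> chart_image c" for x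
    using nonneg [of "chart_inv c x"] C(5,6) [OF that] by (simp add: scalar_curvature_chart [OF c(1)])
  moreover have "scalar_coord (g c) (snd c p) = 0"
    using p by (simp add: scalar_curvature_chart [OF c])
  ultimately obtain r where r: "r > 0" "\<And>x. x \<in> ball (snd c p) r \<Longrightarrow> scalar_coord (g c) x = 0"
    using soliton_zero_set_open [OF smooth_potential [OF c(1)] soliton_chart [OF c(1)] \<rho>_nonneg _ C(3) [OF c(2)]]
    by blast
  define U where "U = fst c \<inter> snd c -` ball (snd c p) r"
  have "open U"
    unfolding U_def by (rule continuous_open_preimage [OF C(7,1) open_ball])
  moreover have "p \<in> U" using c(2) r(1) by (simp add: U_def)
  moreover have "U \<subseteq> {p. scalar_curvature A g p = 0}"
    using r(2) by (auto simp: U_def scalar_curvature_chart [OF c(1)])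
  ultimately show "\<exists>T. open T \<and> p \<in> T \<and> T \<subseteq> {p. scalar_curvature A g p = 0}" by blast
qed

text \<open>A negative value \<open>R p\<close> is below half of itself, hence by the condition at infinity below all
  values outside some compact set \<open>K\<close>. So the minimum over \<open>K\<close> is a global one.\<close>

lemma scalar_curvature_nonneg:
  assumes lim: "liminf_at_infinity (scalar_curvature A g) \<ge> 0"
  shows "scalar_curvature A g p \<ge> 0"
proof (rule ccontr)
  let ?R = "scalar_curvature A g"
  assume "\<not> ?thesis"
  then have neg: "?R p < 0" by simp
  have "ereal (?R p / 2) < 0" using neg by (simp add: zero_ereal_def)
  also have "0 \<le> (SUP K\<in>{K. compact K}. INF x\<in>-K. ereal (?R x))"
    using lim by (simp add: liminf_at_infinity_def)
  finally obtain K where K: "compact K" "ereal (?R p / 2) < (INF x\<in>-K. ereal (?R x))"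
    by (auto simp: less_SUP_iff)
  have outside: "?R p / 2 < ?R x" if "x \<notin> K" for x
    using less_INF_D [OF K(2), of x] that by simp
  have "p \<in> K" using outside [of p] neg by auto
  then obtain q where q: "q \<in> K" "\<And>x. x \<in> K \<Longrightarrow> ?R q \<le> ?R x"
    using continuous_attains_inf [OF K(1) _ continuous_on_subset [OF continuous_scalar_curvature]] by blast
  have "?R q \<le> ?R x" for x
    using q(2) [of x] q(2) [OF \<open>p \<in> K\<close>] outside [of x] neg by (cases "x \<in> K") auto
  then have "?R q \<ge> 0" by (rule no_negative_global_min)
  then show False using q(2) [OF \<open>p \<in> K\<close>] neg by simp
qed

end

theorem theorem1:
  fixes A :: "('a::{t2_space, second_countable_topology}, 'n::finite) chart set"
    and g :: "('a, 'n) metric" and f :: "'a \<Rightarrow> real" and \<rho> :: real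
  assumes "smooth_atlas A"
    and "connected (UNIV :: 'a set)"
    and "riemannian_metric A g"
    and "complete_metric A g"
    and "\<not> compact (UNIV :: 'a set)"
    and "gradient_yamabe_soliton A g f \<rho>"
    and "\<rho> \<ge> 0"
    and "liminf_at_infinity (scalar_curvature A g) \<ge> 0"
  shows "(\<forall>p. scalar_curvature A g p \<ge> 0) \<and>
    ((\<exists>p. scalar_curvature A g p \<noteq> 0) \<longrightarrow> (\<forall>p. scalar_curvature A g p > 0))"
proof -
  interpret yamabe_soliton A g f \<rho>
    using assms by unfold_locales
  have nonneg: "scalar_curvature A g p \<ge> 0" for p
    by (rule scalar_curvature_nonneg) fact
  let ?Z = "{p. scalar_curvature A g p = 0}"
  have "closed ?Z"
    using continuous_closed_preimage_constant [OF continuous_scalar_curvature closed_UNIV, of 0] by simp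
  moreover have "\<forall>T. open T \<and> closed T \<longrightarrow> T = {} \<or> T = (UNIV :: 'a set)"
    using \<open>connected UNIV\<close> by (simp add: connected_clopen)
  ultimately have "?Z = {} \<or> ?Z = UNIV"
    using open_zero_set [OF nonneg] by blast
  then have "(\<exists>p. scalar_curvature A g p \<noteq> 0) \<longrightarrow> (\<forall>p. scalar_curvature A g p > 0)"
    using nonneg by (metis (mono_tags, lifting) empty_iff mem_Collect_eq UNIV_I order_le_less)
  then show ?thesis using nonneg by blast
qed

end
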